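(* Let $t\geqslant 3$ be a fixed integer and let $H_t$ denote the $1$-subdivision of the complete graph $K_t$. Then \[ f_{2}(n,H_{t})=\Omega\!\left(n^{1+\frac{1}{2t-3}}\right) \quad\text{as } n\to\infty. \]
   Context: The $1$-subdivision $H_t$ of $K_t$ is the graph obtained from $K_t$ by replacing each edge with a path of length $2$ (i.e. inserting one new vertex on each edge). For a proper edge-coloring of the complete graph $K_n$, two vertex-disjoint copies of a graph $H$ are called color isomorphic if there is an isomorphism between them that maps each edge to an edge of the same color. For an integer $k\geqslant 2$ and a graph $H$, $f_k(n,H)$ is the smallest number $C$ such that there exists a proper edge-coloring of $K_n$ using $C$ colors which contains no $k$ pairwise vertex-disjoint, pairwise color isomorphic copies of $H$. *)

theory Defs
  imports "HOL-Library.Landau_Symbols" "HOL-Library.Ramsey"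
begin

text \<open>A graph is a pair of a vertex set and a set of two-element vertex sets.\<close>

type_synonym 'a graph = "'a set \<times> 'a set set"

abbreviation verts :: "'a graph \<Rightarrow> 'a set" where "verts \<equiv> fst"

abbreviation edges :: "'a graph \<Rightarrow> 'a set set" where "edges \<equiv> snd"

definition is_graph :: "'a graph \<Rightarrow> bool" where
  "is_graph G \<longleftrightarrow> edges G \<subseteq> [verts G]\<^bsup>2\<^esup>"

definition complete_graph :: "nat \<Rightarrow> nat graph" where
  "complete_graph n = ({..<n}, [{..<n}]\<^bsup>2\<^esup>)"

text \<open>The branch vertices are tagged \<open>Inl\<close>; the vertex inserted on the edge \<open>e\<close> is \<open>Inr e\<close>.\<close>

definition subdivision1 :: "'a graph \<Rightarrow> ('a + 'a set) graph" where
  "subdivision1 G =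
    (Inl ` verts G \<union> Inr ` edges G, {{Inl v, Inr e} | v e. e \<in> edges G \<and> v \<in> e})"

definition subgraph :: "'a graph \<Rightarrow> 'a graph \<Rightarrow> bool" where
  "subgraph X G \<longleftrightarrow> is_graph X \<and> verts X \<subseteq> verts G \<and> edges X \<subseteq> edges G"

definition graph_iso :: "('a \<Rightarrow> 'b) \<Rightarrow> 'a graph \<Rightarrow> 'b graph \<Rightarrow> bool" where
  "graph_iso \<phi> X Y \<longleftrightarrow>
    bij_betw \<phi> (verts X) (verts Y) \<and>
    (\<forall>u\<in>verts X. \<forall>v\<in>verts X. {u, v} \<in> edges X \<longleftrightarrow> {\<phi> u, \<phi> v} \<in> edges Y)"

definition copy_of :: "'b graph \<Rightarrow> 'a graph \<Rightarrow> 'a graph \<Rightarrow> bool" where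
  "copy_of H G X \<longleftrightarrow> subgraph X G \<and> (\<exists>\<phi>. graph_iso \<phi> H X)"

definition proper_edge_coloring :: "'a graph \<Rightarrow> ('a set \<Rightarrow> 'c) \<Rightarrow> bool" where
  "proper_edge_coloring G c \<longleftrightarrow>
    (\<forall>e\<in>edges G. \<forall>e'\<in>edges G. e \<noteq> e' \<and> e \<inter> e' \<noteq> {} \<longrightarrow> c e \<noteq> c e')"

definition color_isomorphic :: "('a set \<Rightarrow> 'c) \<Rightarrow> 'a graph \<Rightarrow> 'a graph \<Rightarrow> bool" where
  "color_isomorphic c X Y \<longleftrightarrow>
    (\<exists>\<phi>. graph_iso \<phi> X Y \<and> (\<forall>e\<in>edges X. c (\<phi> ` e) = c e))"

definition has_color_isomorphic_copies ::
    "nat \<Rightarrow> 'b graph \<Rightarrow> 'a graph \<Rightarrow> ('a set \<Rightarrow> 'c) \<Rightarrow> bool" where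
  "has_color_isomorphic_copies k H G c \<longleftrightarrow>
    (\<exists>S. finite S \<and> card S = k \<and> (\<forall>X\<in>S. copy_of H G X) \<and>
      pairwise (\<lambda>X Y. verts X \<inter> verts Y = {} \<and> color_isomorphic c X Y) S)"

definition f_col :: "nat \<Rightarrow> nat \<Rightarrow> 'b graph \<Rightarrow> nat" where
  "f_col k n H =
    (LEAST C. \<exists>c :: nat set \<Rightarrow> nat.
      proper_edge_coloring (complete_graph n) c \<and>
      card (c ` edges (complete_graph n)) = C \<and>
      \<not> has_color_isomorphic_copies k H (complete_graph n) c)"

text \<open>The minimum is over a nonempty set as soon as \<open>H\<close> has an edge and \<open>k \<ge> 2\<close>: an injective
  colouring admits no two disjoint colour isomorphic copies.\<close>

lemma f_col_attained:
  assumes "is_graph H" "edges H \<noteq> {}" "k \<ge> 2"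
  shows "\<exists>c :: nat set \<Rightarrow> nat.
      proper_edge_coloring (complete_graph n) c \<and>
      card (c ` edges (complete_graph n)) = f_col k n H \<and>
      \<not> has_color_isomorphic_copies k H (complete_graph n) c"
proof -
  let ?G = "complete_graph n"
  have "finite (edges ?G)"
    by (simp add: complete_graph_def finite_imp_finite_nsets)
  then obtain c :: "nat set \<Rightarrow> nat" where c: "inj_on c (edges ?G)"
    using finite_imp_inj_to_nat_seg[of "edges ?G"] by blast
  have "\<not> has_color_isomorphic_copies k H ?G c"
  proof
    assume "has_color_isomorphic_copies k H ?G c"
    then obtain S where S: "finite S" "card S = k" "\<forall>X\<in>S. copy_of H ?G X"
      "pairwise (\<lambda>X Y. verts X \<inter> verts Y = {} \<and> color_isomorphic c X Y) S"
      unfolding has_color_isomorphic_copies_def by blast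
    then obtain X Y where XY: "X \<in> S" "Y \<in> S" "X \<noteq> Y"
      using assms(3) card_le_Suc0_iff_eq[of S] by auto
    then have dis: "verts X \<inter> verts Y = {}" and "color_isomorphic c X Y"
      using S(4) unfolding pairwise_def by blast+
    then obtain \<psi> where psi: "graph_iso \<psi> X Y" "\<forall>e\<in>edges X. c (\<psi> ` e) = c e"
      unfolding color_isomorphic_def by blast
    obtain \<phi> where phi: "graph_iso \<phi> H X" and sub: "subgraph X ?G" "subgraph Y ?G"
      using S(3) XY unfolding copy_of_def by blast
    obtain u v where uv: "{u, v} \<in> edges H" "u \<in> verts H" "v \<in> verts H"
    proof -
      obtain e where e: "e \<in> edges H" using assms(2) by blast
      then have "card e = 2" "e \<subseteq> verts H"
        using assms(1) unfolding is_graph_def nsets_def by auto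
      then show ?thesis using that e unfolding card_2_iff by auto
    qed
    define a b where "a = \<phi> u" and "b = \<phi> v"
    have ab: "{a, b} \<in> edges X" "a \<in> verts X" "b \<in> verts X"
      using phi uv unfolding graph_iso_def a_def b_def by (auto simp: bij_betw_apply)
    then have ab': "{\<psi> a, \<psi> b} \<in> edges Y" "\<psi> a \<in> verts Y"
      using psi(1) unfolding graph_iso_def by (auto simp: bij_betw_apply)
    have "c {\<psi> a, \<psi> b} = c {a, b}" using psi(2) ab(1) by fastforce
    then have "{\<psi> a, \<psi> b} = {a, b}"
      by (rule inj_onD[OF c]) (use ab(1) ab'(1) sub in \<open>auto simp: subgraph_def\<close>)
    then have "\<psi> a \<in> verts X" using ab by (auto simp: doubleton_eq_iff)
    then show False using ab' dis by blast
  qed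
  moreover have "proper_edge_coloring ?G c"
    using c unfolding proper_edge_coloring_def inj_on_def by blast
  ultimately have "\<exists>C. \<exists>c :: nat set \<Rightarrow> nat. proper_edge_coloring ?G c \<and>
      card (c ` edges ?G) = C \<and> \<not> has_color_isomorphic_copies k H ?G c"
    by blast
  then show ?thesis unfolding f_col_def by (rule LeastI_ex)
qed

end

theory Submission imports Defs "HOL-Analysis.Convex"
begin

text \<open>Let \<open>c\<close> be a proper colouring of \<open>K\<^sub>n\<close> with \<open>C\<close> colours. Split the vertices into \<open>X\<close> and \<open>Y\<close>
  and join \<open>(u, u'), (v, v') \<in> X \<times> Y\<close> whenever \<open>c {u, v} = c {u', v'}\<close>. Two disjoint colour isomorphic copies
  of \<open>H\<^sub>t\<close> are given by a copy of \<open>H\<^sub>t\<close> in this auxiliary graph no two of whose vertices share a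
  coordinate. By Cauchy-Schwarz, and averaging over all splits, the auxiliary graph has average
  degree at least of order \<open>n\<^sup>2 / C\<close> on at most \<open>n\<^sup>2\<close> vertices, so it suffices to run Janzer's argument
  for the extremal number of \<open>H\<^sub>t\<close> while avoiding shared coordinates. As \<open>c\<close> is proper, distinct
  neighbours of a vertex share no coordinate, so each vertex rules out at most two candidates in any
  neighbourhood.

  Janzer's argument: call a pair of vertices heavy or light according to its number of common
  neighbours. A heavy \<open>t\<close>-clique extends greedily to a copy. Without one, a positive proportion of
  the pairs in any large neighbourhood is light. So every sufficiently large vertex set contains a
  vertex with many light partners in it, and a light \<open>t\<close>-clique can be built one vertex at a time;
  the few candidates that would create coinciding subdivision vertices are discarded in each step.\<close>

section \<open>Clique-free relations\<close>

lemma card_nsets_2_le: "card ([T]\<^bsup>2\<^esup>) \<le> (card T)\<^sup>2"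
proof -
  have "card T * (card T - 1) div 2 \<le> card T * (card T - 1)" by (rule div_le_dividend)
  also have "\<dots> \<le> card T * card T" by simp
  finally show ?thesis by (simp add: card_nsets choose_two power2_eq_square)
qed

text \<open>If every non-neighbourhood had fewer than |S|/t elements, those of fewer than t vertices
  could not cover \<open>S\<close>, so a clique would grow greedily up to size t. By irreflexivity
  each vertex lies in its own non-neighbourhood, so the uncovered vertex is new.\<close>

lemma clique_free_vertex:
  fixes R :: "'a \<Rightarrow> 'a \<Rightarrow> bool"
  assumes "finite S" "S \<noteq> {}"
    and sym: "\<And>x y. R x y \<Longrightarrow> R y x" and irr: "\<And>x. \<not> R x x"
    and free: "\<And>T. T \<subseteq> S \<Longrightarrow> card T = t \<Longrightarrow> \<exists>x\<in>T. \<exists>y\<in>T. x \<noteq> y \<and> \<not> R x y"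
  shows "\<exists>v\<in>S. card S \<le> t * card {x \<in> S. \<not> R v x}"
proof (rule ccontr)
  assume "\<not> ?thesis"
  then have small: "t * card {x \<in> S. \<not> R v x} < card S" if "v \<in> S" for v
    using that by (meson linorder_not_le)
  have "\<exists>T\<subseteq>S. card T = k \<and> (\<forall>x\<in>T. \<forall>y\<in>T. x \<noteq> y \<longrightarrow> R x y)" if "k \<le> t" for k
    using that
  proof (induction k)
    case 0
    show ?case by (rule exI[of _ "{}"]) simp
  next
    case (Suc k)
    then obtain T where T: "T \<subseteq> S" "card T = k" "\<forall>x\<in>T. \<forall>y\<in>T. x \<noteq> y \<longrightarrow> R x y"
      by auto
    have fT: "finite T" using T(1) assms(1) finite_subset by blast
    have "t * card (\<Union>v\<in>T. {x \<in> S. \<not> R v x}) \<le> (\<Sum>v\<in>T. t * card {x \<in> S. \<not> R v x})"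
      unfolding sum_distrib_left[symmetric] by (rule mult_le_mono2) (rule card_UN_le[OF fT])
    also have "\<dots> \<le> (\<Sum>v\<in>T. card S - 1)"
      by (rule sum_mono) (use small T(1) in force)
    also have "\<dots> = k * (card S - 1)" using T(2) by simp
    also have "\<dots> \<le> k * card S" by simp
    also have "\<dots> < t * card S"
      using Suc.prems assms(1,2) by (simp add: card_gt_0_iff)
    finally have "card (\<Union>v\<in>T. {x \<in> S. \<not> R v x}) < card S" by simp
    moreover have "finite (\<Union>v\<in>T. {x \<in> S. \<not> R v x})" using fT assms(1) by auto
    ultimately have "\<not> S \<subseteq> (\<Union>v\<in>T. {x \<in> S. \<not> R v x})"
      using card_mono by (meson linorder_not_less)
    then obtain x where x: "x \<in> S" "x \<notin> (\<Union>v\<in>T. {x \<in> S. \<not> R v x})"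
      by blast
    have xT: "x \<notin> T" using x irr by auto
    have Rx: "R x v \<and> R v x" if "v \<in> T" for v using x that sym by blast
    show ?case
      by (rule exI[of _ "insert x T"]) (use x(1) xT T fT Rx in auto)
  qed
  then obtain T where "T \<subseteq> S" "card T = t" "\<forall>x\<in>T. \<forall>y\<in>T. x \<noteq> y \<longrightarrow> R x y" by blast
  with free[of T] show False by blast
qed

text \<open>A weak form of Turan's theorem for ordered pairs, diagonal ones included. Peeling off
  the vertex \<open>v\<close> of the previous lemma accounts for at least |S|/t pairs with first
  entry \<open>v\<close>, and \<open>d\<^sup>2 + 2 * (d + 1)\<close> is at least
  \<open>(d + 1)\<^sup>2\<close>.\<close>

lemma clique_free_many_nonadjacent:
  fixes R :: "'a \<Rightarrow> 'a \<Rightarrow> bool"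
  assumes "finite S"
    and sym: "\<And>x y. R x y \<Longrightarrow> R y x" and irr: "\<And>x. \<not> R x x"
    and free: "\<And>T. T \<subseteq> S \<Longrightarrow> card T = t \<Longrightarrow> \<exists>x\<in>T. \<exists>y\<in>T. x \<noteq> y \<and> \<not> R x y"
  shows "(card S)\<^sup>2 \<le> 2 * t * card {(x, y). x \<in> S \<and> y \<in> S \<and> \<not> R x y}"
  using assms(1) free
proof (induction "card S" arbitrary: S)
  case 0
  then show ?case by simp
next
  case (Suc d)
  then have "S \<noteq> {}" by auto
  then obtain v where v: "v \<in> S" "card S \<le> t * card {x \<in> S. \<not> R v x}"
    using clique_free_vertex[OF Suc.prems(1) _ sym irr Suc.prems(2)] by blast
  let ?S = "S - {v}"
  let ?N = "\<lambda>S. {(x, y). x \<in> S \<and> y \<in> S \<and> \<not> R x y}"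
  have fin: "finite (?N S)" if "finite S" for S
    by (rule finite_subset[of _ "S \<times> S"]) (use that in auto)
  have d: "card ?S = d" using Suc v by simp
  have IH: "d\<^sup>2 \<le> 2 * t * card (?N ?S)"
    using Suc.hyps(1)[of ?S] d Suc.prems(1) Suc.prems(2)[OF subset_trans[OF _ Diff_subset]] by simp
  have "card (?N ?S) + card {x \<in> S. \<not> R v x} = card (?N ?S \<union> Pair v ` {x \<in> S. \<not> R v x})"
    using Suc.prems(1) fin[of ?S] by (subst card_Un_disjoint) (auto simp: card_image inj_on_def)
  also have "\<dots> \<le> card (?N S)"
    by (rule card_mono) (use fin Suc.prems(1) v in auto)
  finally have "2 * t * (card (?N ?S) + card {x \<in> S. \<not> R v x}) \<le> 2 * t * card (?N S)"
    by (rule mult_le_mono2)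
  moreover have "2 * t * (card (?N ?S) + card {x \<in> S. \<not> R v x}) \<ge> d\<^sup>2 + 2 * card S"
    using IH v(2) by (simp add: algebra_simps)
  moreover have "(card S)\<^sup>2 \<le> d\<^sup>2 + 2 * card S"
    using Suc.hyps(2)[symmetric] by (simp add: power2_eq_square)
  ultimately show ?case by linarith
qed

text \<open>Some vertex of a large set \<open>U\<close> has at least \<open>light_gain t * \<delta>\<^sup>2 / (2 |A|) * |U|\<close> light partners in \<open>U\<close>, and
  \<open>bad_loss t * \<delta>\<close> bounds the number of candidates discarded per step; above \<open>growth_threshold t\<close>
  at least half of the partners survive.\<close>

definition heavy_bound :: "nat \<Rightarrow> nat" where
  "heavy_bound t = 2 * (t + t\<^sup>2) + 1"

definition light_gain :: "nat \<Rightarrow> real" where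
  "light_gain t = 1 / (4 * real t * real (heavy_bound t))"

definition bad_loss :: "nat \<Rightarrow> real" where
  "bad_loss t = real (4 * t * (t + t\<^sup>2 * heavy_bound t))"

definition growth_threshold :: "nat \<Rightarrow> real" where
  "growth_threshold t = 8 * real t + 4 * bad_loss t / light_gain t"

lemma light_gain_pos: "t > 0 \<Longrightarrow> light_gain t > 0"
proof -
  assume "t > 0"
  moreover have "heavy_bound t > 0" by (simp add: heavy_bound_def)
  ultimately show ?thesis by (simp add: light_gain_def)
qed

section \<open>Subdivided cliques in incidence systems with conflicts\<close>

text \<open>\<open>A\<close> supplies the branch vertices, \<open>B\<close> the candidates for
  subdivision vertices. Later \<open>B\<close> consists of clones of elements of \<open>A\<close>,
  \<open>\<pi>\<close> forgets the clone index, and \<open>conflict\<close> means sharing a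
  coordinate; the bound 2 counts the two coordinates.\<close>

locale pair_incidence =
  fixes A :: "'p set" and B :: "'b set" and E :: "'p \<Rightarrow> 'b \<Rightarrow> bool"
    and \<pi> :: "'b \<Rightarrow> 'p" and conflict :: "'p \<Rightarrow> 'p \<Rightarrow> bool" and \<delta> :: nat
  assumes finA: "finite A" and finB: "finite B"
    and EA: "E a b \<Longrightarrow> a \<in> A" and EB: "E a b \<Longrightarrow> b \<in> B"
    and conflict_refl [simp]: "conflict p p"
    and conflict_sym: "conflict p q \<Longrightarrow> conflict q p"
    and noconf: "E a b \<Longrightarrow> \<not> conflict (\<pi> b) a"
    and confB: "E a b \<Longrightarrow> E a b' \<Longrightarrow> conflict (\<pi> b) (\<pi> b') \<Longrightarrow> b = b'"
    and confA: "E a b \<Longrightarrow> E a' b \<Longrightarrow> conflict a a' \<Longrightarrow> a = a'"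
    and card_conflict_B: "card {b. E a b \<and> conflict (\<pi> b) p} \<le> 2"
    and card_conflict_A: "card {a. E a b \<and> conflict a p} \<le> 2"
    and degA: "a \<in> A \<Longrightarrow> card {b. E a b} = \<delta>"
    and degB: "card {a. E a b} \<le> \<delta>"
begin

definition common_nbrs :: "'p \<Rightarrow> 'p \<Rightarrow> 'b set" where
  "common_nbrs a a' = {b. E a b \<and> E a' b}"

definition heavy :: "nat \<Rightarrow> 'p \<Rightarrow> 'p \<Rightarrow> bool" where
  "heavy s a a' \<longleftrightarrow> \<not> conflict a a' \<and> s \<le> card (common_nbrs a a')"

text \<open>A common neighbour is demanded so that a light pair can be subdivided at all; the upper
  bound limits how many vertices the pair can occupy.\<close>

definition light :: "nat \<Rightarrow> 'p \<Rightarrow> 'p \<Rightarrow> bool" where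
  "light s a a' \<longleftrightarrow> \<not> conflict a a' \<and> common_nbrs a a' \<noteq> {} \<and> card (common_nbrs a a') < s"

text \<open>The edge \<open>e\<close> is subdivided by \<open>y e\<close>. Absence of conflicts is
  stronger than distinctness: it is what makes both coordinate projections injective later.\<close>

definition subdivided_clique :: "'p set \<Rightarrow> ('p set \<Rightarrow> 'b) \<Rightarrow> bool" where
  "subdivided_clique T y \<longleftrightarrow> T \<subseteq> A \<and>
    (\<forall>a\<in>T. \<forall>a'\<in>T. a \<noteq> a' \<longrightarrow> \<not> conflict a a' \<and> y {a, a'} \<in> common_nbrs a a') \<and>
    (\<forall>e\<in>[T]\<^bsup>2\<^esup>. \<forall>a\<in>T. \<not> conflict (\<pi> (y e)) a) \<and>
    (\<forall>e\<in>[T]\<^bsup>2\<^esup>. \<forall>e'\<in>[T]\<^bsup>2\<^esup>. e \<noteq> e' \<longrightarrow> \<not> conflict (\<pi> (y e)) (\<pi> (y e')))"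

lemma common_nbrs_sym: "common_nbrs a a' = common_nbrs a' a"
  by (auto simp: common_nbrs_def)

lemma finite_neighbours: "finite {b. E a b \<and> P b}" "finite {a. E a b \<and> P' a}" "finite (common_nbrs a a')"
proof -
  show "finite {b. E a b \<and> P b}" by (rule finite_subset[OF _ finB]) (use EB in auto)
  show "finite {a. E a b \<and> P' a}" by (rule finite_subset[OF _ finA]) (use EA in auto)
  show "finite (common_nbrs a a')" by (rule finite_subset[OF _ finB]) (use EB in \<open>auto simp: common_nbrs_def\<close>)
qed

lemma heavy_sym: "heavy s a a' \<Longrightarrow> heavy s a' a"
  unfolding heavy_def using common_nbrs_sym conflict_sym by metis

lemma light_sym: "light s a a' \<Longrightarrow> light s a' a"
  unfolding light_def using common_nbrs_sym conflict_sym by metis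

lemma heavy_irrefl: "\<not> heavy s a a"
  by (simp add: heavy_def)

text \<open>Each already used pair rules out at most two of the \<open>s\<close> common neighbours.\<close>

lemma subdivided_clique_if_heavy:
  assumes T: "T \<subseteq> A" "card T = t" and s: "s > 2 * (t + t\<^sup>2)"
    and heavy: "\<And>a a'. a \<in> T \<Longrightarrow> a' \<in> T \<Longrightarrow> a \<noteq> a' \<Longrightarrow> heavy s a a'"
  shows "\<exists>y. subdivided_clique T y"
proof -
  have fT: "finite T" using T(1) finA finite_subset by blast
  \<comment> \<open>The subdivision vertices are chosen edge by edge; \<open>F\<close> collects the
    edges already treated.\<close>
  have "\<exists>y. (\<forall>a\<in>T. \<forall>a'\<in>T. a \<noteq> a' \<longrightarrow> {a, a'} \<in> F \<longrightarrow> y {a, a'} \<in> common_nbrs a a') \<and>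
      (\<forall>e\<in>F. \<forall>a\<in>T. \<not> conflict (\<pi> (y e)) a) \<and>
      (\<forall>e\<in>F. \<forall>e'\<in>F. e \<noteq> e' \<longrightarrow> \<not> conflict (\<pi> (y e)) (\<pi> (y e')))"
    if "finite F" "F \<subseteq> [T]\<^bsup>2\<^esup>" for F
    using that
  proof (induction F rule: finite_induct)
    case empty
    show ?case by simp
  next
    case (insert e F)
    then obtain y where "(\<forall>a\<in>T. \<forall>a'\<in>T. a \<noteq> a' \<longrightarrow> {a, a'} \<in> F \<longrightarrow> y {a, a'} \<in> common_nbrs a a') \<and>
      (\<forall>e\<in>F. \<forall>a\<in>T. \<not> conflict (\<pi> (y e)) a) \<and>
      (\<forall>e\<in>F. \<forall>e'\<in>F. e \<noteq> e' \<longrightarrow> \<not> conflict (\<pi> (y e)) (\<pi> (y e')))"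
      by auto
    then have y: "\<And>a a'. a\<in>T \<Longrightarrow> a'\<in>T \<Longrightarrow> a \<noteq> a' \<Longrightarrow> {a, a'} \<in> F \<Longrightarrow> y {a, a'} \<in> common_nbrs a a'"
      "\<And>e a. e \<in> F \<Longrightarrow> a \<in> T \<Longrightarrow> \<not> conflict (\<pi> (y e)) a"
      "\<And>e e'. e \<in> F \<Longrightarrow> e' \<in> F \<Longrightarrow> e \<noteq> e' \<Longrightarrow> \<not> conflict (\<pi> (y e)) (\<pi> (y e'))"
      by blast+
    obtain a a' where e: "e = {a, a'}" "a \<in> T" "a' \<in> T" "a \<noteq> a'"
      using insert.prems by (auto simp: nsets_def card_2_iff)
    \<comment> \<open>\<open>Q\<close> is everything the new subdivision vertex must avoid: the
      branch vertices and the at most \<open>t\<^sup>2\<close> subdivision vertices placed so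
      far.\<close>
    define Q where "Q = T \<union> (\<lambda>e. \<pi> (y e)) ` F"
    have cF: "card F \<le> t\<^sup>2"
    proof -
      have "card F \<le> card ([T]\<^bsup>2\<^esup>)"
        using insert.prems fT by (intro card_mono) (auto simp: finite_imp_finite_nsets)
      also have "\<dots> \<le> t\<^sup>2"
        using card_nsets_2_le[of T] T(2) by simp
      finally show ?thesis .
    qed
    have fQ: "finite Q" using fT insert.hyps by (simp add: Q_def)
    have cQ: "card Q \<le> t + t\<^sup>2"
      unfolding Q_def using card_Un_le[of T "(\<lambda>e. \<pi> (y e)) ` F"] card_image_le[OF insert.hyps(1), of "\<lambda>e. \<pi> (y e)"] cF T(2)
      by linarith
    have "card (\<Union>q\<in>Q. {b. E a b \<and> conflict (\<pi> b) q}) \<le> (\<Sum>q\<in>Q. card {b. E a b \<and> conflict (\<pi> b) q})"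
      by (rule card_UN_le[OF fQ])
    also have "\<dots> \<le> (\<Sum>q\<in>Q. 2)" by (rule sum_mono) (rule card_conflict_B)
    also have "\<dots> \<le> 2 * (t + t\<^sup>2)" using cQ by simp
    also have "\<dots> < card (common_nbrs a a')" using s heavy[OF e(2,3,4)] by (simp add: heavy_def)
    finally have "\<not> common_nbrs a a' \<subseteq> (\<Union>q\<in>Q. {b. E a b \<and> conflict (\<pi> b) q})"
      using card_mono[of "\<Union>q\<in>Q. {b. E a b \<and> conflict (\<pi> b) q}" "common_nbrs a a'"] fQ finite_neighbours(1)
      by (meson finite_UN linorder_not_less)
    then obtain b where b: "b \<in> common_nbrs a a'" "\<And>q. q \<in> Q \<Longrightarrow> \<not> conflict (\<pi> b) q"
      by (auto simp: common_nbrs_def)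
    define y' where "y' = y(e := b)"
    have "y' {c, c'} \<in> common_nbrs c c'" if "c \<in> T" "c' \<in> T" "c \<noteq> c'" "{c, c'} \<in> insert e F" for c c'
    proof (cases "{c, c'} = e")
      case True
      then have "common_nbrs c c' = common_nbrs a a'" using e common_nbrs_sym by (auto simp: doubleton_eq_iff)
      then show ?thesis using True b by (simp add: y'_def)
    next
      case False
      then show ?thesis using that y(1) by (simp add: y'_def)
    qed
    moreover have "\<not> conflict (\<pi> (y' e')) c" if "c \<in> T" "e' \<in> insert e F" for e' c
      using that y(2) b(2) by (auto simp: y'_def Q_def)
    moreover have "\<not> conflict (\<pi> (y' e1)) (\<pi> (y' e2))"
      if "e1 \<in> insert e F" "e2 \<in> insert e F" "e1 \<noteq> e2" for e1 e2
    proof -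
      have "\<not> conflict (\<pi> b) (\<pi> (y e'))" "\<not> conflict (\<pi> (y e')) (\<pi> b)" if "e' \<in> F" for e'
        using b(2)[of "\<pi> (y e')"] conflict_sym that by (auto simp: Q_def)
      then show ?thesis using that y(3) by (auto simp: y'_def)
    qed
    ultimately show ?case by blast
  qed
  from this[of "[T]\<^bsup>2\<^esup>"] obtain y where
    y: "\<forall>a\<in>T. \<forall>a'\<in>T. a \<noteq> a' \<longrightarrow> {a, a'} \<in> [T]\<^bsup>2\<^esup> \<longrightarrow> y {a, a'} \<in> common_nbrs a a'"
      "\<forall>e\<in>[T]\<^bsup>2\<^esup>. \<forall>a\<in>T. \<not> conflict (\<pi> (y e)) a"
      "\<forall>e\<in>[T]\<^bsup>2\<^esup>. \<forall>e'\<in>[T]\<^bsup>2\<^esup>. e \<noteq> e' \<longrightarrow> \<not> conflict (\<pi> (y e)) (\<pi> (y e'))"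
    using fT by (auto simp: finite_imp_finite_nsets)
  have "{a, a'} \<in> [T]\<^bsup>2\<^esup>" if "a \<in> T" "a' \<in> T" "a \<noteq> a'" for a a'
    using that by (auto simp: nsets_def)
  then have "\<forall>a\<in>T. \<forall>a'\<in>T. a \<noteq> a' \<longrightarrow> \<not> conflict a a' \<and> y {a, a'} \<in> common_nbrs a a'"
    using y(1) heavy unfolding heavy_def by blast
  then show ?thesis
    using y(2,3) T(1) unfolding subdivided_clique_def by blast
qed


section \<open>Light pairs inside large vertex sets\<close>

lemma sum_degrees:
  assumes "U \<subseteq> A"
  shows "(\<Sum>b\<in>B. card {a \<in> U. E a b}) = \<delta> * card U"
proof -
  have fU: "finite U" using assms finA finite_subset by blast
  have "{b \<in> B. E a b} = {b. E a b}" for a using EB by blast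
  then have "\<forall>a\<in>U. card {b \<in> B. E a b} = \<delta>" using degA assms by auto
  then have "(\<Sum>b\<in>B. card {a \<in> U. E a b}) = (\<Sum>a\<in>U. \<delta>)"
    by (intro sum_multicount_gen finB fU)
  then show ?thesis by simp
qed

text \<open>Light pairs are counted through their common neighbours. The neighbourhood of
  \<open>b\<close> in \<open>U\<close> has no heavy \<open>t\<close>-clique, so the weak Turan bound
  yields order \<open>(d b)\<^sup>2\<close> non-heavy pairs there. Cauchy-Schwarz sums this over
  \<open>b\<close>, each light pair is counted fewer than \<open>s\<close> times, and averaging over
  \<open>U\<close> finds \<open>u\<close>.\<close>

lemma many_light_neighbours:
  assumes U: "U \<subseteq> A" "U \<noteq> {}"
    and free: "\<And>T. T \<subseteq> A \<Longrightarrow> card T = t \<Longrightarrow> \<exists>x\<in>T. \<exists>y\<in>T. x \<noteq> y \<and> \<not> heavy s x y"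
    and big: "4 * t * card B \<le> \<delta> * card U"
  shows "\<exists>u\<in>U. \<delta>\<^sup>2 * card U \<le> 4 * t * s * card B * card {v \<in> U. light s u v}"
proof (rule ccontr)
  assume neg: "\<not> ?thesis"
  have fU: "finite U" using U(1) finA finite_subset by blast
  define d where "d = (\<lambda>b. card {a \<in> U. E a b})"
  define L where "L = {(x, y). x \<in> U \<and> y \<in> U \<and> light s x y}"
  define S where "S = \<delta> * card U"
  have fL: "finite L" unfolding L_def by (rule finite_subset[of _ "U \<times> U"]) (use fU in auto)
  have sumd: "(\<Sum>b\<in>B. d b) = S" unfolding d_def S_def by (rule sum_degrees[OF U(1)])
  \<comment> \<open>The extra \<open>d b\<close> accounts for the diagonal pairs, which are
    non-heavy without being light.\<close>
  have db: "(d b)\<^sup>2 \<le> 2 * t * (card {p \<in> L. b \<in> common_nbrs (fst p) (snd p)} + d b)" for b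
  proof -
    let ?N = "{a \<in> U. E a b}"
    have "(d b)\<^sup>2 \<le> 2 * t * card {(x, y). x \<in> ?N \<and> y \<in> ?N \<and> \<not> heavy s x y}"
      unfolding d_def
    proof (rule clique_free_many_nonadjacent)
      show "\<exists>x\<in>T. \<exists>y\<in>T. x \<noteq> y \<and> \<not> heavy s x y" if "T \<subseteq> ?N" "card T = t" for T
        using free[of T] that U(1) by blast
    qed (use fU heavy_sym heavy_irrefl in auto)
    also have "card {(x, y). x \<in> ?N \<and> y \<in> ?N \<and> \<not> heavy s x y}
        \<le> card ({p \<in> L. b \<in> common_nbrs (fst p) (snd p)} \<union> (\<lambda>x. (x, x)) ` ?N)"
    proof (rule card_mono)
      show "{(x, y). x \<in> ?N \<and> y \<in> ?N \<and> \<not> heavy s x y}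
          \<subseteq> {p \<in> L. b \<in> common_nbrs (fst p) (snd p)} \<union> (\<lambda>x. (x, x)) ` ?N"
      proof clarsimp
        fix x y assume *: "x \<in> U" "y \<in> U" "E x b" "E y b" "\<not> heavy s x y"
          "(x, y) \<notin> (\<lambda>x. (x, x)) ` ?N"
        \<comment> \<open>Distinct neighbours of \<open>b\<close> never conflict, so a non-heavy
          pair of them fails the size bound and is light.\<close>
        then have "\<not> conflict x y" using confA by blast
        moreover have "b \<in> common_nbrs x y" using * by (simp add: common_nbrs_def)
        ultimately show "(x, y) \<in> L \<and> b \<in> common_nbrs x y"
          using * unfolding L_def light_def heavy_def by auto
      qed
    qed (use fL fU in auto)
    also have "\<dots> \<le> card {p \<in> L. b \<in> common_nbrs (fst p) (snd p)} + d b"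
      unfolding d_def by (rule order_trans[OF card_Un_le]) (simp add: card_image_le fU)
    finally show ?thesis by simp
  qed
  have sumL: "(\<Sum>b\<in>B. card {p \<in> L. b \<in> common_nbrs (fst p) (snd p)}) \<le> s * card L"
  proof -
    have "(\<Sum>b\<in>B. card {p \<in> L. b \<in> common_nbrs (fst p) (snd p)}) = (\<Sum>p\<in>L. card (common_nbrs (fst p) (snd p)))"
    proof (rule sum_multicount_gen[OF finB fL])
      have "{b \<in> B. b \<in> common_nbrs x y} = common_nbrs x y" for x y using EB by (auto simp: common_nbrs_def)
      then show "\<forall>p\<in>L. card {b \<in> B. b \<in> common_nbrs (fst p) (snd p)} = card (common_nbrs (fst p) (snd p))" by simp
    qed
    also have "\<dots> \<le> (\<Sum>p\<in>L. s)" by (rule sum_mono) (auto simp: L_def light_def)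
    finally show ?thesis by (simp add: mult.commute)
  qed
  have "S\<^sup>2 \<le> card B * (\<Sum>b\<in>B. (d b)\<^sup>2)"
  proof -
    have "(\<Sum>b\<in>B. real (d b))\<^sup>2 \<le> (\<Sum>b\<in>B. (real (d b))\<^sup>2) * card B"
      by (rule sum_squared_le_sum_of_squares)
    then have "real (S\<^sup>2) \<le> real (card B * (\<Sum>b\<in>B. (d b)\<^sup>2))"
      unfolding sumd[symmetric] by (simp add: mult.commute)
    then show ?thesis by (simp only: of_nat_le_iff)
  qed
  also have "\<dots> \<le> card B * (\<Sum>b\<in>B. 2 * t * (card {p \<in> L. b \<in> common_nbrs (fst p) (snd p)} + d b))"
    by (intro mult_le_mono2 sum_mono db)
  also have "\<dots> = 2 * t * card B * ((\<Sum>b\<in>B. card {p \<in> L. b \<in> common_nbrs (fst p) (snd p)}) + S)"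
    unfolding sumd[symmetric] sum.distrib[symmetric] sum_distrib_left[symmetric] by simp
  also have "\<dots> \<le> 2 * t * card B * (s * card L + S)"
    using sumL by simp
  finally have 1: "S\<^sup>2 \<le> 2 * t * card B * s * card L + 2 * t * card B * S"
    by (simp add: algebra_simps)
  \<comment> \<open>By \<open>big\<close> the diagonal contributes at most half of
    \<open>S\<^sup>2\<close>.\<close>
  have "2 * (2 * t * card B * S) \<le> S\<^sup>2"
    using mult_le_mono1[OF big[folded S_def], of S] by (simp add: power2_eq_square mult.assoc)
  with 1 have "S\<^sup>2 \<le> 2 * (2 * t * card B * s * card L)" by linarith
  then have le: "S\<^sup>2 \<le> 4 * t * s * card B * card L" by (simp add: ac_simps)
  have "L = (SIGMA x:U. {v \<in> U. light s x v})" by (auto simp: L_def)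
  then have "card L = (\<Sum>u\<in>U. card {v \<in> U. light s u v})"
    using fU by (simp add: card_SigmaI)
  then have "4 * t * s * card B * card L = (\<Sum>u\<in>U. 4 * t * s * card B * card {v \<in> U. light s u v})"
    by (simp add: sum_distrib_left)
  also have "\<dots> < (\<Sum>u\<in>U. \<delta>\<^sup>2 * card U)"
    by (rule sum_strict_mono) (use neg fU U in \<open>auto simp: not_le\<close>)
  also have "\<dots> = S\<^sup>2" by (simp add: S_def power2_eq_square)
  finally show False using le by simp
qed

section \<open>Good sets and the candidates they exclude\<close>

text \<open>All common neighbours count as used, not one per edge, so that no subdivision vertex has
  to be fixed before the clique is complete.\<close>

definition used :: "'p set \<Rightarrow> 'p set" where
  "used T = T \<union> \<pi> ` (\<Union>e\<in>{(a, a'). a \<in> T \<and> a' \<in> T \<and> a \<noteq> a'}. common_nbrs (fst e) (snd e))"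

text \<open>Either the candidate \<open>v\<close> or a subdivision vertex \<open>b\<close> between
  \<open>v\<close> and \<open>T\<close> would hit something occupied. Only vertices joined to
  \<open>T\<close> by a path of length two are included, since others cannot be light partners; this
  keeps the set of order \<open>\<delta>\<close>.\<close>

definition bad :: "'p set \<Rightarrow> 'p set" where
  "bad T = {v. \<exists>q\<in>used T. \<exists>a\<in>T. \<exists>b. E a b \<and> E v b \<and> (conflict v q \<or> conflict (\<pi> b) q)}"

text \<open>In a good set any choice of common neighbours yields a subdivided clique.\<close>

definition good :: "nat \<Rightarrow> 'p set \<Rightarrow> bool" where
  "good s T \<longleftrightarrow> T \<subseteq> A \<and>
    (\<forall>a\<in>T. \<forall>a'\<in>T. a \<noteq> a' \<longrightarrow> light s a a' \<and> (\<forall>b\<in>common_nbrs a a'. \<forall>p\<in>T. \<not> conflict (\<pi> b) p)) \<and>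
    (\<forall>a\<in>T. \<forall>a'\<in>T. \<forall>c\<in>T. \<forall>c'\<in>T. a \<noteq> a' \<longrightarrow> c \<noteq> c' \<longrightarrow> {a, a'} \<noteq> {c, c'} \<longrightarrow>
      (\<forall>b\<in>common_nbrs a a'. \<forall>b'\<in>common_nbrs c c'. \<not> conflict (\<pi> b) (\<pi> b')))"

lemma finite_used: "finite T \<Longrightarrow> finite (used T)"
proof -
  assume "finite T"
  then have "finite {(a, a'). a \<in> T \<and> a' \<in> T \<and> a \<noteq> a'}"
    by (rule_tac finite_subset[of _ "T \<times> T"]) auto
  then show ?thesis using \<open>finite T\<close> finite_neighbours(3) by (auto simp: used_def)
qed

lemma card_used_le:
  assumes "good s T"
  shows "card (used T) \<le> card T + (card T)\<^sup>2 * s"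
proof -
  have fT: "finite T" using assms finA finite_subset by (auto simp: good_def)
  let ?P = "{(a, a'). a \<in> T \<and> a' \<in> T \<and> a \<noteq> a'}"
  have sub: "?P \<subseteq> T \<times> T" by auto
  then have fP: "finite ?P" using fT finite_subset by blast
  have "card ?P \<le> (card T)\<^sup>2"
    using card_mono[OF _ sub] fT by (simp add: card_cartesian_product power2_eq_square)
  have fU: "finite (\<Union>e\<in>?P. common_nbrs (fst e) (snd e))" using fP finite_neighbours(3) by auto
  have "card (\<pi> ` (\<Union>e\<in>?P. common_nbrs (fst e) (snd e))) \<le> card (\<Union>e\<in>?P. common_nbrs (fst e) (snd e))"
    by (rule card_image_le[OF fU])
  also have "\<dots> \<le> (\<Sum>e\<in>?P. card (common_nbrs (fst e) (snd e)))" by (rule card_UN_le[OF fP])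
  also have "\<dots> \<le> (\<Sum>e\<in>?P. s)"
  proof (rule sum_mono)
    fix e assume "e \<in> ?P"
    then have "light s (fst e) (snd e)" using assms by (auto simp: good_def)
    then show "card (common_nbrs (fst e) (snd e)) \<le> s" by (simp add: light_def)
  qed
  also have "\<dots> \<le> (card T)\<^sup>2 * s" using \<open>card ?P \<le> _\<close> by simp
  finally show ?thesis
    unfolding used_def using card_Un_le[of T "\<pi> ` (\<Union>e\<in>?P. common_nbrs (fst e) (snd e))"] by linarith
qed

text \<open>For fixed \<open>a\<close> and \<open>q\<close> the paths \<open>a\<close>,
  \<open>b\<close>, \<open>v\<close> are counted: if \<open>v\<close> conflicts with
  \<open>q\<close>, there are \<open>\<delta>\<close> choices of \<open>b\<close> and then at most 2
  of \<open>v\<close>; if \<open>\<pi> b\<close> does, at most 2 of \<open>b\<close> and then at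
  most \<open>\<delta>\<close> of \<open>v\<close>.\<close>

lemma card_bad_le:
  assumes T: "T \<subseteq> A"
  shows "card (bad T) \<le> 4 * card T * card (used T) * \<delta>"
proof -
  have fT: "finite T" using T finA finite_subset by blast
  define F G where
    "F = (\<lambda>(a, q). \<Union>b\<in>{b. E a b}. {v. E v b \<and> conflict v q})" and
    "G = (\<lambda>(a, q). \<Union>b\<in>{b. E a b \<and> conflict (\<pi> b) q}. {v. E v b})"
  have F: "card (F x) \<le> 2 * \<delta>" if x: "x \<in> T \<times> used T" for x
  proof -
    obtain a q where xe: "x = (a, q)" "a \<in> T" using x by auto
    have "card (F x) \<le> (\<Sum>b\<in>{b. E a b}. card {v. E v b \<and> conflict v q})"
      unfolding F_def xe prod.case by (rule card_UN_le) (use finite_neighbours(1)[of a "\<lambda>_. True"] in simp)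
    also have "\<dots> \<le> (\<Sum>b\<in>{b. E a b}. 2)" by (rule sum_mono) (rule card_conflict_A)
    finally show ?thesis using degA[of a] xe T by auto
  qed
  have G: "card (G x) \<le> 2 * \<delta>" if x: "x \<in> T \<times> used T" for x
  proof -
    obtain a q where xe: "x = (a, q)" using x by auto
    have "card (G x) \<le> (\<Sum>b\<in>{b. E a b \<and> conflict (\<pi> b) q}. card {v. E v b})"
      unfolding G_def xe prod.case by (rule card_UN_le) (rule finite_neighbours(1))
    also have "\<dots> \<le> (\<Sum>b\<in>{b. E a b \<and> conflict (\<pi> b) q}. \<delta>)" by (rule sum_mono) (rule degB)
    also have "\<dots> \<le> 2 * \<delta>" using card_conflict_B[of a q] by simp
    finally show ?thesis .
  qed
  have fin: "finite (T \<times> used T)" using fT finite_used by blast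
  have "bad T = (\<Union>x\<in>T \<times> used T. F x \<union> G x)"
    unfolding bad_def F_def G_def by auto
  then have "card (bad T) \<le> (\<Sum>x\<in>T \<times> used T. card (F x \<union> G x))"
    using card_UN_le[OF fin] by simp
  also have "\<dots> \<le> (\<Sum>x\<in>T \<times> used T. 4 * \<delta>)"
  proof (rule sum_mono)
    fix x assume "x \<in> T \<times> used T"
    then show "card (F x \<union> G x) \<le> 4 * \<delta>"
      using F[of x] G[of x] card_Un_le[of "F x" "G x"] by linarith
  qed
  also have "\<dots> = 4 * card T * card (used T) * \<delta>"
    by (simp add: card_cartesian_product)
  finally show ?thesis .
qed

text \<open>Avoiding \<open>bad T\<close> separates the new edges from the old ones. Two new
  subdivision vertices are both adjacent to \<open>v\<close>, so a conflict makes them equal; the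
  common value is then a common neighbour of two elements of \<open>T\<close>, hence already
  used.\<close>

lemma good_insert:
  assumes T: "good s T" and v: "v \<in> A" "v \<notin> bad T" "\<And>a. a \<in> T \<Longrightarrow> light s a v"
  shows "good s (insert v T)"
proof -
  have old: "\<pi> b \<in> used T" if "b \<in> common_nbrs a a'" "a \<in> T" "a' \<in> T" "a \<noteq> a'" for a a' b
    using that unfolding used_def by fastforce
  have vlight: "light s a v \<and> light s v a" if "a \<in> T" for a using v(3) that light_sym by blast
  \<comment> \<open>\<open>v\<close> is light with \<open>a\<close>, so a path of length two joins
    them, and the conflict would place \<open>v\<close> in \<open>bad T\<close> by its first
    alternative.\<close>
  have oldv: "\<not> conflict (\<pi> b) v" if b: "b \<in> common_nbrs a a'" and aa: "a \<in> T" "a' \<in> T" "a \<noteq> a'" for a a' b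
  proof
    assume "conflict (\<pi> b) v"
    moreover obtain b' where "E a b'" "E v b'"
      using v(3)[OF aa(1)] by (auto simp: light_def common_nbrs_def)
    ultimately have "v \<in> bad T" using old[OF b aa] aa conflict_sym unfolding bad_def by blast
    then show False using v(2) by blast
  qed
  have new: "\<not> conflict (\<pi> b) q" if "E a b" "E v b" "a \<in> T" "q \<in> used T" for a b q
    using that v(2) unfolding bad_def by blast
  have newv: "\<not> conflict (\<pi> b) v" if "E v b" for b using that noconf by blast
  have newnew: "\<not> conflict (\<pi> b) (\<pi> b')"
    if "E a b" "E v b" "E a' b'" "E v b'" "a \<in> T" "a' \<in> T" "a \<noteq> a'" for a a' b b'
  proof
    assume c: "conflict (\<pi> b) (\<pi> b')"
    then have "b = b'" using confB that by blast
    then have "\<pi> b' \<in> used T" using old[of b' a a'] that by (auto simp: common_nbrs_def)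
    then show False using new c that by blast
  qed
  have Tin: "q \<in> used T" if "q \<in> T" for q using that by (simp add: used_def)
  have 1: "light s a a' \<and> (\<forall>b\<in>common_nbrs a a'. \<forall>p\<in>insert v T. \<not> conflict (\<pi> b) p)"
    if aa: "a \<in> insert v T" "a' \<in> insert v T" "a \<noteq> a'" for a a'
  proof (cases "a \<in> T \<and> a' \<in> T")
    case True
    then show ?thesis using T oldv that(3) unfolding good_def by blast
  next
    case False
    then obtain c where c: "c \<in> T" "(a = c \<and> a' = v) \<or> (a = v \<and> a' = c)" using aa by blast
    then have "E c b \<and> E v b" if "b \<in> common_nbrs a a'" for b using that by (auto simp: common_nbrs_def)
    then show ?thesis using c vlight new newv Tin by blast
  qed
  \<comment> \<open>One edge is new, the other arbitrary; symmetry of \<open>conflict\<close> and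
    \<open>common_nbrs\<close> reduces all cases with a new edge to this one.\<close>
  have half: "\<not> conflict (\<pi> b) (\<pi> b')"
    if aa: "a \<in> T" "c \<in> insert v T" "c' \<in> insert v T" "c \<noteq> c'" "{a, v} \<noteq> {c, c'}"
      and b: "b \<in> common_nbrs a v" "b' \<in> common_nbrs c c'" for a c c' b b'
  proof (cases "c \<in> T \<and> c' \<in> T")
    case True
    then have "\<pi> b' \<in> used T" using old b(2) aa(4) by blast
    then show ?thesis using new[of a b "\<pi> b'"] b(1) aa(1) by (auto simp: common_nbrs_def)
  next
    case False
    then obtain x where x: "x \<in> T" "(c = x \<and> c' = v) \<or> (c = v \<and> c' = x)" using aa by blast
    then have "E x b' \<and> E v b'" "x \<noteq> a" using b(2) aa(5) by (auto simp: common_nbrs_def)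
    then show ?thesis using newnew[of a b x b'] x(1) aa(1) b(1) by (auto simp: common_nbrs_def)
  qed
  have 2: "\<not> conflict (\<pi> b) (\<pi> b')"
    if aa: "a \<in> insert v T" "a' \<in> insert v T" "c \<in> insert v T" "c' \<in> insert v T"
      "a \<noteq> a'" "c \<noteq> c'" "{a, a'} \<noteq> {c, c'}" and b: "b \<in> common_nbrs a a'" "b' \<in> common_nbrs c c'" for a a' c c' b b'
  proof (cases "a \<in> T \<and> a' \<in> T")
    case True
    show ?thesis
    proof (cases "c \<in> T \<and> c' \<in> T")
      case True
      then have "\<forall>b\<in>common_nbrs a a'. \<forall>b'\<in>common_nbrs c c'. \<not> conflict (\<pi> b) (\<pi> b')"
        using \<open>a \<in> T \<and> a' \<in> T\<close> T aa(5-7) unfolding good_def by blast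
      then show ?thesis using b by blast
    next
      case False
      then obtain x where x: "x \<in> T" "(c = x \<and> c' = v) \<or> (c = v \<and> c' = x)" using aa by blast
      then have "b' \<in> common_nbrs x v" "{x, v} \<noteq> {a, a'}" using b(2) aa(7) common_nbrs_sym[of v x] by auto
      then show ?thesis using half[of x a a' b' b] x(1) aa(1,2,5) b(1) conflict_sym by blast
    qed
  next
    case False
    then obtain x where x: "x \<in> T" "(a = x \<and> a' = v) \<or> (a = v \<and> a' = x)" using aa by blast
    then have "b \<in> common_nbrs x v" "{x, v} \<noteq> {c, c'}" using b(1) aa(7) common_nbrs_sym[of v x] by auto
    then show ?thesis using half[of x c c' b b'] x(1) aa(3,4,6) b(2) by blast
  qed
  have "insert v T \<subseteq> A" using T v(1) by (auto simp: good_def)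
  moreover have "\<forall>a\<in>insert v T. \<forall>a'\<in>insert v T. a \<noteq> a' \<longrightarrow>
      light s a a' \<and> (\<forall>b\<in>common_nbrs a a'. \<forall>p\<in>insert v T. \<not> conflict (\<pi> b) p)"
    using 1 by blast
  moreover have "\<forall>a\<in>insert v T. \<forall>a'\<in>insert v T. \<forall>c\<in>insert v T. \<forall>c'\<in>insert v T.
      a \<noteq> a' \<longrightarrow> c \<noteq> c' \<longrightarrow> {a, a'} \<noteq> {c, c'} \<longrightarrow>
      (\<forall>b\<in>common_nbrs a a'. \<forall>b'\<in>common_nbrs c c'. \<not> conflict (\<pi> b) (\<pi> b'))"
    by (intro ballI impI) (rule 2)
  ultimately show ?thesis unfolding good_def by (intro conjI)
qed

lemma subdivided_clique_if_good:
  assumes "good s T"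
  shows "\<exists>y. subdivided_clique T y"
proof -
  \<comment> \<open>The choice depends on the unordered edge only; symmetry of
    \<open>common_nbrs\<close> makes it valid for both orientations.\<close>
  define y where "y = (\<lambda>e. SOME b. \<exists>a a'. e = {a, a'} \<and> b \<in> common_nbrs a a')"
  have y: "y {a, a'} \<in> common_nbrs a a'" if "a \<in> T" "a' \<in> T" "a \<noteq> a'" for a a'
  proof -
    have "common_nbrs a a' \<noteq> {}" using assms that by (auto simp: good_def light_def)
    then have "\<exists>b c c'. {a, a'} = {c, c'} \<and> b \<in> common_nbrs c c'" by blast
    then have "\<exists>c c'. {a, a'} = {c, c'} \<and> y {a, a'} \<in> common_nbrs c c'"
      unfolding y_def by (rule someI_ex)
    then show ?thesis using common_nbrs_sym[of a a'] by (auto simp: doubleton_eq_iff)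
  qed
  have "\<not> conflict a a'" if "a \<in> T" "a' \<in> T" "a \<noteq> a'" for a a'
    using assms that by (auto simp: good_def light_def)
  moreover have "\<not> conflict (\<pi> (y e)) p" if "e \<in> [T]\<^bsup>2\<^esup>" "p \<in> T" for e p
    using that(1)
  proof (rule nsets2_E)
    fix a a' assume "e = {a, a'}" "a \<in> T" "a' \<in> T" "a \<noteq> a'"
    then show ?thesis using y that(2) assms unfolding good_def by blast
  qed
  moreover have "\<not> conflict (\<pi> (y e)) (\<pi> (y e'))" if "e \<in> [T]\<^bsup>2\<^esup>" "e' \<in> [T]\<^bsup>2\<^esup>" "e \<noteq> e'" for e e'
    using that(1)
  proof (rule nsets2_E)
    fix a a' assume a: "e = {a, a'}" "a \<in> T" "a' \<in> T" "a \<noteq> a'"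
    show ?thesis using that(2)
    proof (rule nsets2_E)
      fix c c' assume c: "e' = {c, c'}" "c \<in> T" "c' \<in> T" "c \<noteq> c'"
      have "\<forall>b\<in>common_nbrs a a'. \<forall>b'\<in>common_nbrs c c'. \<not> conflict (\<pi> b) (\<pi> b')"
        using assms a c that(3) unfolding good_def by blast
      then show ?thesis using y[of a a'] y[of c c'] a c by blast
    qed
  qed
  moreover have "T \<subseteq> A" using assms by (simp add: good_def)
  ultimately have "subdivided_clique T y" using y unfolding subdivided_clique_def by simp
  then show ?thesis by blast
qed

section \<open>Growing a light clique\<close>

text \<open>\<open>U\<close> holds the candidates still admissible for \<open>T\<close>. A vertex
  \<open>u\<close> with many light partners in \<open>U\<close> joins \<open>T\<close>, and these
  partners, without the bad ones, become the new candidates; \<open>big\<close> ensures that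
  discarding costs at most half of the guaranteed number.\<close>

lemma light_extension:
  assumes t: "t > 0" and U: "U \<subseteq> A" "U \<noteq> {}" and T: "good (heavy_bound t) T" "card T < t"
    and inv: "\<And>v. v \<in> U \<Longrightarrow> v \<notin> bad T \<and> (\<forall>a\<in>T. light (heavy_bound t) a v)"
    and free: "\<And>T. T \<subseteq> A \<Longrightarrow> card T = t \<Longrightarrow> \<exists>x\<in>T. \<exists>y\<in>T. x \<noteq> y \<and> \<not> heavy (heavy_bound t) x y"
    and B: "card B \<le> 2 * card A"
    and big: "growth_threshold t * card A \<le> \<delta> * real (card U)"
  shows "\<exists>T' U'. good (heavy_bound t) T' \<and> card T' = Suc (card T) \<and> U' \<subseteq> A \<and>
    (\<forall>v\<in>U'. v \<notin> bad T' \<and> (\<forall>a\<in>T'. light (heavy_bound t) a v)) \<and>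
    light_gain t * (real \<delta>)\<^sup>2 / (4 * card A) * card U \<le> card U'"
proof -
  let ?s = "heavy_bound t"
  have s: "?s > 0" by (simp add: heavy_bound_def)
  have \<alpha>: "light_gain t > 0" using t by (rule light_gain_pos)
  have \<beta>: "bad_loss t \<ge> 0" by (simp add: bad_loss_def)
  have m: "card A > 0" using U finA by (metis card_gt_0_iff subset_empty)
  have R: "8 * real t \<le> growth_threshold t" "4 * bad_loss t / light_gain t \<le> growth_threshold t"
    using \<alpha> \<beta> by (simp_all add: growth_threshold_def)
  \<comment> \<open>The summand \<open>8 * real t\<close> of the threshold provides the size
    condition of \<open>many_light_neighbours\<close>, as \<open>B\<close> is at most twice as large
    as \<open>A\<close>.\<close>
  have "4 * t * card B \<le> 8 * t * card A" using B by simp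
  then have "real (4 * t * card B) \<le> 8 * real t * card A"
    by (metis of_nat_le_iff of_nat_mult of_nat_numeral)
  also have "\<dots> \<le> \<delta> * real (card U)"
    using big mult_right_mono[OF R(1), of "real (card A)"] by linarith
  finally have "real (4 * t * card B) \<le> real (\<delta> * card U)" by simp
  then have "4 * t * card B \<le> \<delta> * card U" by (simp only: of_nat_le_iff)
  from many_light_neighbours[OF U free this]
  obtain u where u: "u \<in> U" "\<delta>\<^sup>2 * card U \<le> 4 * t * ?s * card B * card {v \<in> U. light ?s u v}"
    by blast
  define l where "l = card {v \<in> U. light ?s u v}"
  have "\<delta>\<^sup>2 * card U \<le> 4 * t * ?s * card B * l" using u(2) by (simp add: l_def)
  also have "\<dots> \<le> 4 * t * ?s * (2 * card A) * l" using B by simp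
  finally have "real (\<delta>\<^sup>2 * card U) \<le> real (4 * t * ?s * (2 * card A) * l)"
    by (simp only: of_nat_le_iff)
  then have l: "light_gain t * (real \<delta>)\<^sup>2 / (2 * card A) * card U \<le> l"
    using t s m by (simp add: light_gain_def field_simps)
  define T' where "T' = insert u T"
  define U' where "U' = {v \<in> U. light ?s u v} - bad T'"
  have fT: "finite T" using T(1) finA finite_subset by (auto simp: good_def)
  have uT: "u \<notin> T" using inv[OF u(1)] by (auto simp: light_def)
  have gT': "good ?s T'" unfolding T'_def
    using good_insert[OF T(1)] u(1) U(1) inv by blast
  have cT': "card T' = Suc (card T)" using fT uT by (simp add: T'_def)
  have "card (used T') \<le> card T' + (card T')\<^sup>2 * ?s" by (rule card_used_le[OF gT'])
  also have "\<dots> \<le> t + t\<^sup>2 * ?s"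
    using cT' T(2) by (intro add_mono mult_le_mono1 power_mono) auto
  finally have cu: "card (used T') \<le> t + t\<^sup>2 * ?s" .
  have "card (bad T') \<le> 4 * card T' * card (used T') * \<delta>"
    by (rule card_bad_le) (use gT' in \<open>simp add: good_def\<close>)
  also have "\<dots> \<le> 4 * t * (t + t\<^sup>2 * ?s) * \<delta>"
    using cT' T(2) cu by (intro mult_le_mono) auto
  finally have cb: "real (card (bad T')) \<le> bad_loss t * \<delta>"
    unfolding bad_loss_def of_nat_mult[symmetric] by (simp only: of_nat_le_iff)
  have fb: "finite (bad T')"
    by (rule finite_subset[OF _ finA]) (use EA in \<open>auto simp: bad_def\<close>)
  have "l \<le> card U' + card (bad T')"
    unfolding l_def U'_def using card_Diff_subset_Int[of "bad T'"] fb
    by (metis diff_card_le_card_Diff le_diff_conv)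
  then have lU': "real l - bad_loss t * \<delta> \<le> card U'" using cb by linarith
  \<comment> \<open>The second summand of the threshold makes the loss at most half of the lower
    bound for \<open>l\<close>.\<close>
  have "bad_loss t * \<delta> \<le> light_gain t * (real \<delta>)\<^sup>2 / (4 * card A) * card U"
  proof -
    have "4 * bad_loss t / light_gain t * card A \<le> \<delta> * real (card U)"
      using big mult_right_mono[OF R(2), of "real (card A)"] by linarith
    then have "4 * bad_loss t * card A \<le> light_gain t * (\<delta> * real (card U))"
      using \<alpha> by (simp add: field_simps)
    then have "4 * bad_loss t * card A * \<delta> \<le> light_gain t * (\<delta> * real (card U)) * \<delta>"
      by (rule mult_right_mono) simp
    then show ?thesis using m by (simp add: field_simps power2_eq_square)
  qed
  moreover have "light_gain t * (real \<delta>)\<^sup>2 / (2 * card A) * card U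
      = 2 * (light_gain t * (real \<delta>)\<^sup>2 / (4 * card A) * card U)"
    by (simp add: field_simps)
  ultimately have "light_gain t * (real \<delta>)\<^sup>2 / (4 * card A) * card U \<le> card U'"
    using l lU' by linarith
  moreover have "\<forall>v\<in>U'. v \<notin> bad T' \<and> (\<forall>a\<in>T'. light ?s a v)"
    using inv by (auto simp: U'_def T'_def)
  moreover have "U' \<subseteq> A" using U(1) by (auto simp: U'_def)
  ultimately show ?thesis using gT' cT' by blast
qed

text \<open>Each extension keeps at least the fraction of candidates given by the minimum in
  \<open>big\<close>, capped at 1 so that its powers decrease. The threshold must hold before each
  of \<open>t - 1\<close> extensions, and \<open>t - 2\<close> shrinkings precede the last of them;
  hence the exponent.\<close>

theorem subdivided_clique_exists:
  assumes t: "t \<ge> 2" and A: "A \<noteq> {}" and B: "card B \<le> 2 * card A"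
    and big: "growth_threshold t \<le> \<delta> * (min 1 (light_gain t * (real \<delta>)\<^sup>2 / (4 * card A))) ^ (t - 2)"
  shows "\<exists>T y. card T = t \<and> subdivided_clique T y"
proof (rule ccontr)
  assume no: "\<not> ?thesis"
  let ?s = "heavy_bound t"
  define q where "q = min 1 (light_gain t * (real \<delta>)\<^sup>2 / (4 * card A))"
  have \<alpha>: "light_gain t > 0" using t by (intro light_gain_pos) simp
  have Rpos: "growth_threshold t > 0"
    using t \<alpha> by (auto simp: growth_threshold_def bad_loss_def intro!: add_pos_nonneg)
  have m: "card A > 0" using A finA by (simp add: card_gt_0_iff)
  have q0: "q \<ge> 0" using \<alpha> by (simp add: q_def)
  have q1: "q \<le> 1" by (simp add: q_def)
  have dpos: "\<delta> > 0"
    using big Rpos by (cases "\<delta> = 0") auto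
  then have qpos: "q > 0" using \<alpha> m by (simp add: q_def)
  \<comment> \<open>\<open>heavy_bound t\<close> exceeds \<open>2 * (t + t\<^sup>2)\<close> by one,
    just what the greedy subdivision of a heavy clique requires.\<close>
  have free: "\<exists>x\<in>T. \<exists>y\<in>T. x \<noteq> y \<and> \<not> heavy ?s x y" if "T \<subseteq> A" "card T = t" for T
    using subdivided_clique_if_heavy[OF that, of ?s] no that(2) by (auto simp: heavy_bound_def)
  have "\<exists>T U. good ?s T \<and> card T = k \<and> U \<subseteq> A \<and>
      (\<forall>v\<in>U. v \<notin> bad T \<and> (\<forall>a\<in>T. light ?s a v)) \<and> q ^ k * card A \<le> card U"
    if "k \<le> t - 1" for k
    using that
  proof (induction k)
    case 0
    have "good ?s {}" "bad {} = {}" by (auto simp: good_def bad_def)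
    then show ?case by (intro exI[of _ "{}"] exI[of _ A]) auto
  next
    case (Suc k)
    then obtain T U where TU: "good ?s T" "card T = k" "U \<subseteq> A"
      "\<forall>v\<in>U. v \<notin> bad T \<and> (\<forall>a\<in>T. light ?s a v)" "q ^ k * card A \<le> card U" by auto
    have "q ^ (t - 2) \<le> q ^ k" using Suc.prems q0 q1 by (intro power_decreasing) auto
    then have "\<delta> * q ^ (t - 2) * card A \<le> \<delta> * (q ^ k * card A)"
      unfolding mult.assoc by (intro mult_left_mono mult_right_mono) auto
    also have "\<dots> \<le> \<delta> * real (card U)" using TU(5) by (intro mult_left_mono) auto
    finally have big': "growth_threshold t * card A \<le> \<delta> * real (card U)"
      using mult_right_mono[OF big[folded q_def], of "real (card A)"] by simp
    then have "U \<noteq> {}" using Rpos m by (auto simp: mult_le_0_iff)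
    have "\<exists>T' U'. good ?s T' \<and> card T' = Suc (card T) \<and> U' \<subseteq> A \<and>
        (\<forall>v\<in>U'. v \<notin> bad T' \<and> (\<forall>a\<in>T'. light ?s a v)) \<and>
        light_gain t * (real \<delta>)\<^sup>2 / (4 * card A) * card U \<le> card U'"
    proof (rule light_extension[OF _ TU(3) \<open>U \<noteq> {}\<close> TU(1) _ _ free B big'])
      show "t > 0" "card T < t" using t TU(2) Suc.prems by auto
      show "v \<notin> bad T \<and> (\<forall>a\<in>T. light ?s a v)" if "v \<in> U" for v using TU(4) that by blast
    qed
    then obtain T' U' where TU': "good ?s T'" "card T' = Suc k" "U' \<subseteq> A"
      "\<forall>v\<in>U'. v \<notin> bad T' \<and> (\<forall>a\<in>T'. light ?s a v)"
      "light_gain t * (real \<delta>)\<^sup>2 / (4 * card A) * card U \<le> card U'" unfolding TU(2) by blast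
    have "q ^ Suc k * card A \<le> q * card U"
      using mult_left_mono[OF TU(5) q0] by (simp add: mult.assoc)
    also have "\<dots> \<le> light_gain t * (real \<delta>)\<^sup>2 / (4 * card A) * card U"
      by (rule mult_right_mono) (auto simp: q_def)
    finally have "q ^ Suc k * card A \<le> card U'" using TU'(5) by linarith
    then show ?case using TU'(1-4) by blast
  qed
  from this[of "t - 1"] obtain T U where TU: "good ?s T" "card T = t - 1" "U \<subseteq> A"
    "\<forall>v\<in>U. v \<notin> bad T \<and> (\<forall>a\<in>T. light ?s a v)" "q ^ (t - 1) * card A \<le> card U" by auto
  \<comment> \<open>For the last vertex a nonempty candidate set is enough; no threshold is involved
    any more.\<close>
  have "0 < q ^ (t - 1) * card A" using qpos m by simp
  then have "U \<noteq> {}" using TU(5) by auto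
  then obtain u where u: "u \<in> U" by blast
  have "good ?s (insert u T)" using good_insert[OF TU(1)] u TU(3,4) by blast
  then obtain y where "subdivided_clique (insert u T) y" using subdivided_clique_if_good by blast
  have "finite T" using TU(1) finA finite_subset by (auto simp: good_def)
  moreover have "u \<notin> T" using TU(4) u conflict_refl unfolding light_def by blast
  ultimately have "card (insert u T) = t" using TU(2) t by simp
  then show False using no \<open>subdivided_clique (insert u T) y\<close> by blast
qed

end

section \<open>From the auxiliary graph to colour isomorphic copies\<close>

definition image_graph :: "('a \<Rightarrow> 'b) \<Rightarrow> 'a graph \<Rightarrow> 'b graph" where
  "image_graph f H = (f ` verts H, (`) f ` edges H)"

lemma graph_iso_image_graph:
  assumes "is_graph H" "inj_on f (verts H)"
  shows "graph_iso f H (image_graph f H)"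
proof -
  have inj: "inj_on ((`) f) (Pow (verts H))"
    using assms(2) by (rule inj_on_image_Pow)
  have sub: "edges H \<subseteq> Pow (verts H)" using assms(1) by (auto simp: is_graph_def nsets_def)
  have "{u, v} \<in> edges H \<longleftrightarrow> {f u, f v} \<in> (`) f ` edges H" if "u \<in> verts H" "v \<in> verts H" for u v
    using inj_on_image_mem_iff[OF inj _ sub, of "{u, v}"] that by simp
  then show ?thesis using assms(2) by (simp add: graph_iso_def image_graph_def bij_betw_def)
qed

lemma copy_of_image_graph:
  assumes H: "is_graph H" and f: "inj_on f (verts H)" "f ` verts H \<subseteq> {..<n}"
  shows "copy_of H (complete_graph n) (image_graph f H)"
proof -
  have *: "f ` e \<in> [f ` verts H]\<^bsup>2\<^esup>" if "e \<in> edges H" for e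
  proof -
    have e: "e \<subseteq> verts H" "card e = 2" "finite e" using that H by (auto simp: is_graph_def nsets_def)
    then have "card (f ` e) = 2" using f(1) by (metis card_image inj_on_subset)
    then show ?thesis using e by (auto simp: nsets_def)
  qed
  then have "edges (image_graph f H) \<subseteq> [{..<n}]\<^bsup>2\<^esup>"
    using nsets_mono[OF f(2)] by (auto simp: image_graph_def)
  then have "subgraph (image_graph f H) (complete_graph n)"
    using * f(2) by (auto simp: subgraph_def is_graph_def image_graph_def complete_graph_def)
  then show ?thesis using graph_iso_image_graph[OF H f(1)] by (auto simp: copy_of_def)
qed

lemma color_isomorphic_image_graphs:
  assumes H: "is_graph H" and f: "inj_on f (verts H)" and g: "inj_on g (verts H)"
    and c: "\<And>e. e \<in> edges H \<Longrightarrow> c (g ` e) = c (f ` e)"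
  shows "color_isomorphic c (image_graph f H) (image_graph g H)"
proof -
  define h where "h = g \<circ> inv_into (verts H) f"
  have h: "h (f v) = g v" if "v \<in> verts H" for v using that f by (simp add: h_def)
  have "bij_betw h (f ` verts H) (g ` verts H)"
    unfolding h_def using f g
    by (intro bij_betw_trans[of _ _ "verts H"]) (auto simp: bij_betw_inv_into bij_betw_def inj_on_inv_into)
  moreover have "{f u, f v} \<in> (`) f ` edges H \<longleftrightarrow> {h (f u), h (f v)} \<in> (`) g ` edges H"
    if "u \<in> verts H" "v \<in> verts H" for u v
    using that graph_iso_image_graph[OF H f] graph_iso_image_graph[OF H g] h
    by (auto simp: graph_iso_def image_graph_def)
  ultimately have "graph_iso h (image_graph f H) (image_graph g H)"
    by (auto simp: graph_iso_def image_graph_def)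
  moreover have "c (h ` e) = c e" if "e \<in> edges (image_graph f H)" for e
  proof -
    obtain e' where e': "e' \<in> edges H" "e = f ` e'" using \<open>e \<in> _\<close> by (auto simp: image_graph_def)
    then have "e' \<subseteq> verts H" using H by (auto simp: is_graph_def nsets_def)
    then have "h ` e = g ` e'" using h e'(2) by (force simp: image_image)
    then show ?thesis using c e' by simp
  qed
  ultimately show ?thesis by (auto simp: color_isomorphic_def)
qed

lemma has_two_color_isomorphic_copies:
  assumes H: "is_graph H" "verts H \<noteq> {}"
    and f: "inj_on f (verts H)" "f ` verts H \<subseteq> X" and g: "inj_on g (verts H)" "g ` verts H \<subseteq> Y"
    and XY: "X \<inter> Y = {}" "X \<subseteq> {..<n}" "Y \<subseteq> {..<n}"
    and c: "\<And>e. e \<in> edges H \<Longrightarrow> c (f ` e) = c (g ` e)"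
  shows "has_color_isomorphic_copies 2 H (complete_graph n) c"
proof -
  let ?F = "image_graph f H" and ?G = "image_graph g H"
  have dis: "verts ?F \<inter> verts ?G = {}" using f(2) g(2) XY(1) by (auto simp: image_graph_def)
  \<comment> \<open>Disjoint vertex sets that are nonempty show that the two images are different
    graphs, so the set of copies has exactly two elements.\<close>
  have "verts ?F \<noteq> {}" using H(2) by (simp add: image_graph_def)
  then have "?F \<noteq> ?G" using dis by auto
  then have "card {?F, ?G} = 2" by simp
  moreover have "copy_of H (complete_graph n) ?F" "copy_of H (complete_graph n) ?G"
    using copy_of_image_graph H(1) f g XY by (meson subset_trans)+
  moreover have "color_isomorphic c ?F ?G" "color_isomorphic c ?G ?F"
    using color_isomorphic_image_graphs[OF H(1)] f(1) g(1) c by metis+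
  then have "pairwise (\<lambda>X Y. verts X \<inter> verts Y = {} \<and> color_isomorphic c X Y) {?F, ?G}"
    using dis by (auto simp: pairwise_insert)
  ultimately show ?thesis unfolding has_color_isomorphic_copies_def
    by (intro exI[of _ "{?F, ?G}"]) simp
qed

lemma is_graph_subdivision1:
  assumes "is_graph G"
  shows "is_graph (subdivision1 G)"
  unfolding is_graph_def
proof
  fix e assume "e \<in> edges (subdivision1 G)"
  then obtain v e' where e: "e = {Inl v, Inr e'}" "e' \<in> edges G" "v \<in> e'"
    by (auto simp: subdivision1_def)
  then have "v \<in> verts G" using assms by (auto simp: is_graph_def nsets_def)
  then show "e \<in> [verts (subdivision1 G)]\<^bsup>2\<^esup>" using e by (simp add: subdivision1_def)
qed

section \<open>The auxiliary graph on pairs of vertices\<close>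

text \<open>The inequalities ensure that both sets are genuine edges rather than singletons, about
  which a proper colouring says nothing.\<close>

definition pair_adj :: "(nat set \<Rightarrow> nat) \<Rightarrow> nat \<times> nat \<Rightarrow> nat \<times> nat \<Rightarrow> bool" where
  "pair_adj c p q \<longleftrightarrow>
    fst p \<noteq> fst q \<and> snd p \<noteq> snd q \<and> c {fst p, fst q} = c {snd p, snd q}"

definition meets :: "'x \<times> 'z \<Rightarrow> 'x \<times> 'z \<Rightarrow> bool" where
  "meets p q \<longleftrightarrow> fst p = fst q \<or> snd p = snd q"

lemma pair_adj_sym: "pair_adj c p q \<Longrightarrow> pair_adj c q p"
  by (auto simp: pair_adj_def insert_commute)

text \<open>At most one element agrees with \<open>p\<close> in the first coordinate, and at most
  one in the second.\<close>

lemma card_meets_le_2: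
  assumes "\<And>x y. x \<in> S \<Longrightarrow> y \<in> S \<Longrightarrow> meets (g x) (g y) \<Longrightarrow> x = y"
  shows "card {x \<in> S. meets (g x) p} \<le> 2"
proof -
  have one: "card Z \<le> 1" if "\<And>x y. x \<in> Z \<Longrightarrow> y \<in> Z \<Longrightarrow> x = y" for Z :: "'a set"
    using that by (metis One_nat_def card.empty card.infinite card_le_Suc0_iff_eq zero_le)
  have "card {x \<in> S. fst (g x) = fst p} \<le> 1" "card {x \<in> S. snd (g x) = snd p} \<le> 1"
    by (rule one, rule assms; simp add: meets_def)+
  moreover have "{x \<in> S. meets (g x) p} = {x \<in> S. fst (g x) = fst p} \<union> {x \<in> S. snd (g x) = snd p}"
    by (auto simp: meets_def)
  ultimately show ?thesis
    using card_Un_le[of "{x \<in> S. fst (g x) = fst p}" "{x \<in> S. snd (g x) = snd p}"] by simp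
qed

lemma proper_edge_coloring_complete_graphD:
  assumes "proper_edge_coloring (complete_graph n) c"
    and "x < n" "y < n" "z < n" "x \<noteq> z" "y \<noteq> z" "c {x, z} = c {y, z}"
  shows "x = y"
proof (rule ccontr)
  assume "x \<noteq> y"
  then have "{x, z} \<noteq> {y, z}" using assms by (auto simp: doubleton_eq_iff)
  then show False
    using assms unfolding proper_edge_coloring_def complete_graph_def by auto
qed

text \<open>Where \<open>p\<close> and \<open>q\<close> agree in a coordinate, their edges to
  \<open>r\<close> coincide and have one colour. In the other coordinate their edges to
  \<open>r\<close> share an endpoint and this same colour, so propriety makes them equal.\<close>

lemma pair_adj_meets_eq:
  assumes c: "proper_edge_coloring (complete_graph n) c"
    and V: "p \<in> {..<n} \<times> {..<n}" "q \<in> {..<n} \<times> {..<n}" "r \<in> {..<n} \<times> {..<n}"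
    and adj: "pair_adj c p r" "pair_adj c q r" and m: "meets p q"
  shows "p = q"
proof -
  have "fst p = fst q \<longleftrightarrow> snd p = snd q"
    using V adj proper_edge_coloring_complete_graphD[OF c, of "fst p" "fst q" "fst r"]
      proper_edge_coloring_complete_graphD[OF c, of "snd p" "snd q" "snd r"]
    by (auto simp: pair_adj_def)
  then show ?thesis using m by (auto simp: meets_def prod_eq_iff)
qed

text \<open>Every vertex keeps exactly \<open>\<delta>\<close> of its neighbours, and a vertex chosen by more than \<open>\<delta>\<close>
  others is split into clones of degree at most \<open>\<delta>\<close>. At most \<open>2 |A|\<close> clones arise, so this
  replaces the usual passage to an almost regular subgraph.\<close>

lemma pair_incidence_exists:
  assumes c: "proper_edge_coloring (complete_graph n) c"
    and A: "A \<subseteq> {..<n} \<times> {..<n}" and \<delta>: "\<delta> > 0"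
    and deg: "\<And>a. a \<in> A \<Longrightarrow> \<delta> \<le> card {b \<in> A. pair_adj c a b}"
  shows "\<exists>(B :: ((nat \<times> nat) \<times> nat) set) E. pair_incidence A B E fst meets \<delta> \<and>
    card B \<le> 2 * card A \<and> (\<forall>a b. E a b \<longrightarrow> fst b \<in> A \<and> pair_adj c a (fst b))"
proof -
  have finA: "finite A" using A finite_subset by blast
  have "\<exists>N. N \<subseteq> {b \<in> A. pair_adj c a b} \<and> card N = \<delta>" if "a \<in> A" for a
    using obtain_subset_with_card_n[OF deg[OF that]] by metis
  then obtain N where N: "\<And>a. a \<in> A \<Longrightarrow> N a \<subseteq> {b \<in> A. pair_adj c a b}" "\<And>a. a \<in> A \<Longrightarrow> card (N a) = \<delta>"
    by metis
  define M where "M p = {a \<in> A. p \<in> N a}" for p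
  have finM: "finite (M p)" for p using finA by (simp add: M_def)
  have "\<exists>h. bij_betw h (M p) {0..<card (M p)}" for p
    by (rule ex_bij_betw_finite_nat[OF finM])
  then obtain h where h: "\<And>p. bij_betw (h p) (M p) {0..<card (M p)}" by metis
  \<comment> \<open>The choosers of \<open>p\<close> are numbered and cut into blocks of length
    \<open>\<delta>\<close>; the clone \<open>(p, i)\<close> serves block \<open>i\<close>. As each
    chooser has one number, it uses a single clone of \<open>p\<close>.\<close>
  define E where "E a b \<longleftrightarrow> a \<in> M (fst b) \<and> h (fst b) a div \<delta> = snd b" for a and b :: "(nat \<times> nat) \<times> nat"
  \<comment> \<open>The index range includes its upper end for an incomplete last block. This costs
    one clone per vertex; the complete blocks number at most |A|, since only
    \<open>\<delta> * card A\<close> choices are made in total.\<close>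
  define B where "B = (SIGMA p:A. {..card (M p) div \<delta>})"
  have adj: "a \<in> A \<and> fst b \<in> A \<and> pair_adj c a (fst b)" if "E a b" for a b
    using that N(1)[of a] by (auto simp: E_def M_def)
  have inV: "a \<in> {..<n} \<times> {..<n}" if "a \<in> A" for a using A that by blast
  have confB: "b = b'" if "E a b" "E a b'" "meets (fst b) (fst b')" for a b b'
  proof -
    have "fst b = fst b'"
      using that adj[of a b] adj[of a b'] inV pair_adj_sym
      by (intro pair_adj_meets_eq[OF c, of _ _ a]) blast+
    moreover from this have "snd b = snd b'" using that by (simp add: E_def)
    ultimately show ?thesis by (rule prod_eqI)
  qed
  have confA: "a = a'" if "E a b" "E a' b" "meets a a'" for a a' b
    using that adj[of a b] adj[of a' b] inV by (intro pair_adj_meets_eq[OF c, of _ _ "fst b"]) blast+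
  have "pair_incidence A B E fst meets \<delta>"
  proof
    show "finite A" by (rule finA)
    show "finite B" using finA by (simp add: B_def)
    show "a \<in> A" if "E a b" for a b using adj that by blast
    show "b \<in> B" if E: "E a b" for a b
    proof -
      have "a \<in> M (fst b)" using E by (simp add: E_def)
      then have "h (fst b) a < card (M (fst b))" using h[of "fst b"] by (auto simp: bij_betw_def)
      then have "h (fst b) a div \<delta> \<le> card (M (fst b)) div \<delta>" by (intro div_le_mono) simp
      then show ?thesis using E adj[OF E] by (cases b) (simp add: B_def E_def)
    qed
    show "meets p p" for p :: "nat \<times> nat" by (simp add: meets_def)
    show "meets q p" if "meets p q" for p q :: "nat \<times> nat" using that by (auto simp: meets_def)
    show "\<not> meets (fst b) a" if "E a b" for a b
      using adj[OF that] by (auto simp: pair_adj_def meets_def)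
    show "b = b'" if "E a b" "E a b'" "meets (fst b) (fst b')" for a b b' using confB that .
    show "a = a'" if "E a b" "E a' b" "meets a a'" for a a' b using confA that .
    show "card {b. E a b \<and> meets (fst b) p} \<le> 2" for a p
      using card_meets_le_2[of "{b. E a b}" fst p] confB by simp
    show "card {a. E a b \<and> meets a p} \<le> 2" for b p
      using card_meets_le_2[of "{a. E a b}" "\<lambda>a. a" p] confA by simp
    show "card {b. E a b} = \<delta>" if a: "a \<in> A" for a
    proof -
      have "{b. E a b} = (\<lambda>p. (p, h p a div \<delta>)) ` N a"
        using a by (auto simp: E_def M_def image_iff)
      then show ?thesis using N(2)[OF a] by (simp add: card_image inj_on_def)
    qed
    show "card {a. E a b} \<le> \<delta>" for b
    proof -
      have "inj_on (h (fst b)) {a. E a b}"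
        using h[of "fst b"] by (auto simp: bij_betw_def E_def inj_on_def)
      then have "card {a. E a b} = card (h (fst b) ` {a. E a b})" by (simp add: card_image)
      also have "\<dots> \<le> card {snd b * \<delta>..<snd b * \<delta> + \<delta>}"
      proof (rule card_mono)
        have "snd b * \<delta> \<le> x \<and> x < snd b * \<delta> + \<delta>" if "x div \<delta> = snd b" for x
          using that \<delta> div_mult_mod_eq[of x \<delta>] mod_less_divisor[OF \<delta>, of x] by (metis add_less_cancel_left le_add1)
        then show "h (fst b) ` {a. E a b} \<subseteq> {snd b * \<delta>..<snd b * \<delta> + \<delta>}" by (auto simp: E_def)
      qed simp
      finally show ?thesis by simp
    qed
  qed
  moreover have "card B \<le> 2 * card A"
  proof -
    have "(\<Sum>p\<in>A. card (M p)) = (\<Sum>a\<in>A. \<delta>)"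
      unfolding M_def
    proof (rule sum_multicount_gen[OF finA finA])
      have "{i \<in> A. i \<in> N a} = N a" if "a \<in> A" for a using N(1)[OF that] by blast
      then show "\<forall>a\<in>A. card {i \<in> A. i \<in> N a} = \<delta>" using N(2) by simp
    qed
    then have "\<delta> * card A = (\<Sum>p\<in>A. card (M p))" by simp
    also have "\<dots> \<ge> (\<Sum>p\<in>A. \<delta> * (card (M p) div \<delta>))" by (rule sum_mono) simp
    finally have "\<delta> * (\<Sum>p\<in>A. card (M p) div \<delta>) \<le> \<delta> * card A" by (simp add: sum_distrib_left)
    then have "(\<Sum>p\<in>A. card (M p) div \<delta>) \<le> card A" using \<delta> by simp
    moreover have "card B = (\<Sum>p\<in>A. card (M p) div \<delta>) + card A"
      unfolding B_def using finA by (simp add: sum_Suc)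
    ultimately show ?thesis by simp
  qed
  ultimately show ?thesis using adj by blast
qed

text \<open>The two coordinate projections of an embedded subdivision are the copies: no two of its
  vertices meet, so both projections are injective, and adjacency in the auxiliary graph equates the
  colours.\<close>

lemma copies_if_min_degree:
  assumes c: "proper_edge_coloring (complete_graph n) c"
    and XY: "X \<inter> Y = {}" "X \<subseteq> {..<n}" "Y \<subseteq> {..<n}"
    and A: "A \<subseteq> X \<times> Y" "A \<noteq> {}" and \<delta>: "\<delta> > 0"
    and deg: "\<And>a. a \<in> A \<Longrightarrow> \<delta> \<le> card {b \<in> A. pair_adj c a b}"
    and t: "t \<ge> 2"
    and big: "growth_threshold t \<le> \<delta> * (min 1 (light_gain t * (real \<delta>)\<^sup>2 / (4 * card A))) ^ (t - 2)"
  shows "has_color_isomorphic_copies 2 (subdivision1 (complete_graph t)) (complete_graph n) c"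
proof -
  have "A \<subseteq> {..<n} \<times> {..<n}" using A(1) XY by blast
  then obtain B :: "((nat \<times> nat) \<times> nat) set" and E where BE: "pair_incidence A B E fst meets \<delta>"
    "card B \<le> 2 * card A" "\<And>a b. E a b \<Longrightarrow> fst b \<in> A \<and> pair_adj c a (fst b)"
    using pair_incidence_exists[OF c _ \<delta> deg] by metis
  interpret pair_incidence A B E fst meets \<delta> by (rule BE(1))
  obtain T y where T: "card T = t" "subdivided_clique T y"
    using subdivided_clique_exists[OF t A(2) BE(2) big] by blast
  have "finite T" using T(1) t by (intro card_ge_0_finite) simp
  then obtain f where f: "bij_betw f {..<t} T"
    using T(1) ex_bij_betw_nat_finite[of T] by (auto simp: atLeast0LessThan)
  \<comment> \<open>Branch vertices go to \<open>T\<close> along \<open>f\<close>; the vertex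
    inserted on \<open>e\<close> goes to the pair underlying the clone that subdivides the image of
    \<open>e\<close> under \<open>f\<close>.\<close>
  define \<Phi> where "\<Phi> = case_sum f (\<lambda>e. fst (y (f ` e)))"
  let ?H = "subdivision1 (complete_graph t)"
  have vH: "verts ?H = Inl ` {..<t} \<union> Inr ` [{..<t}]\<^bsup>2\<^esup>"
    by (simp add: subdivision1_def complete_graph_def)
  have eH: "edges ?H = {{Inl v, Inr e} | v e. e \<in> [{..<t}]\<^bsup>2\<^esup> \<and> v \<in> e}"
    by (simp add: subdivision1_def complete_graph_def)
  have fT: "f i \<in> T" if "i < t" for i using f that by (auto simp: bij_betw_def)
  have fe: "bij_betw ((`) f) ([{..<t}]\<^bsup>2\<^esup>) ([T]\<^bsup>2\<^esup>)" by (rule bij_betw_nsets[OF f])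
  have feT: "f ` e \<in> [T]\<^bsup>2\<^esup>" if "e \<in> [{..<t}]\<^bsup>2\<^esup>" for e using fe that by (auto simp: bij_betw_def)
  have yE: "E a (y e)" if "e \<in> [T]\<^bsup>2\<^esup>" "a \<in> e" for e a
    using that(1)
  proof (rule nsets2_E)
    fix u v assume *: "e = {u, v}" "u \<in> T" "v \<in> T" "u \<noteq> v"
    then have "y {u, v} \<in> common_nbrs u v" using T(2) unfolding subdivided_clique_def by blast
    then show ?thesis using * that(2) by (auto simp: common_nbrs_def)
  qed
  have adj: "pair_adj c (\<Phi> (Inl v)) (\<Phi> (Inr e))" if "e \<in> [{..<t}]\<^bsup>2\<^esup>" "v \<in> e" for v e
    using BE(3) yE[OF feT[OF that(1)], of "f v"] that(2) by (auto simp: \<Phi>_def)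
  have \<Phi>A: "\<Phi> x \<in> A" if "x \<in> verts ?H" for x
  proof -
    have "T \<subseteq> A" using T(2) by (simp add: subdivided_clique_def)
    moreover have "fst (y e) \<in> A" if "e \<in> [T]\<^bsup>2\<^esup>" for e
      using that by (rule nsets2_E) (use BE(3) yE[OF that] in blast)
    ultimately show ?thesis using that fT feT unfolding vH \<Phi>_def by auto
  qed
  have nm: "\<not> meets (\<Phi> x) (\<Phi> x')" if x: "x \<in> verts ?H" "x' \<in> verts ?H" "x \<noteq> x'" for x x'
  proof -
    have 1: "\<not> meets (f i) (f j)" if "i < t" "j < t" "i \<noteq> j" for i j
    proof -
      have "f i \<noteq> f j" using f that by (auto simp: bij_betw_def inj_on_def)
      then show ?thesis using T(2) fT that unfolding subdivided_clique_def by blast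
    qed
    have 2: "\<not> meets (fst (y (f ` e))) (f i)" "\<not> meets (f i) (fst (y (f ` e)))"
      if "i < t" "e \<in> [{..<t}]\<^bsup>2\<^esup>" for e i
    proof -
      show "\<not> meets (fst (y (f ` e))) (f i)"
        using T(2) fT[OF that(1)] feT[OF that(2)] unfolding subdivided_clique_def by blast
      then show "\<not> meets (f i) (fst (y (f ` e)))" using conflict_sym by blast
    qed
    have 3: "\<not> meets (fst (y (f ` e))) (fst (y (f ` e')))"
      if "e \<in> [{..<t}]\<^bsup>2\<^esup>" "e' \<in> [{..<t}]\<^bsup>2\<^esup>" "e \<noteq> e'" for e e'
    proof -
      have "f ` e \<noteq> f ` e'" using inj_on_eq_iff[OF bij_betw_imp_inj_on[OF fe]] that by blast
      moreover have "\<forall>e\<in>[T]\<^bsup>2\<^esup>. \<forall>e'\<in>[T]\<^bsup>2\<^esup>. e \<noteq> e' \<longrightarrow> \<not> meets (fst (y e)) (fst (y e'))"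
        using T(2) unfolding subdivided_clique_def by (elim conjE)
      ultimately show ?thesis using feT[OF that(1)] feT[OF that(2)] by simp
    qed
    have "x \<in> Inl ` {..<t} \<or> x \<in> Inr ` [{..<t}]\<^bsup>2\<^esup>" "x' \<in> Inl ` {..<t} \<or> x' \<in> Inr ` [{..<t}]\<^bsup>2\<^esup>"
      using x unfolding vH by blast+
    then show ?thesis using x(3) by (elim disjE imageE) (simp_all add: \<Phi>_def 1 2 3)
  qed
  have inj: "inj_on (fst \<circ> \<Phi>) (verts ?H)" "inj_on (snd \<circ> \<Phi>) (verts ?H)"
    by (rule inj_onI, rule ccontr, use nm in \<open>force simp: meets_def\<close>)+
  show ?thesis
  proof (rule has_two_color_isomorphic_copies[OF _ _ inj(1) _ inj(2) _ XY])
    show "is_graph ?H"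
      by (rule is_graph_subdivision1) (simp add: is_graph_def complete_graph_def)
    have "Inl 0 \<in> verts ?H" using t unfolding vH by simp
    then show "verts ?H \<noteq> {}" by blast
    show "(fst \<circ> \<Phi>) ` verts ?H \<subseteq> X" "(snd \<circ> \<Phi>) ` verts ?H \<subseteq> Y" using \<Phi>A A(1) by fastforce+
    show "c ((fst \<circ> \<Phi>) ` e) = c ((snd \<circ> \<Phi>) ` e)" if e: "e \<in> edges ?H" for e
    proof -
      obtain v e' where "e = {Inl v, Inr e'}" "e' \<in> [{..<t}]\<^bsup>2\<^esup>" "v \<in> e'" using e unfolding eH by blast
      then show ?thesis using adj[of e' v] by (simp add: pair_adj_def)
    qed
  qed
qed

section \<open>Counting monochromatic quadruples\<close>

text \<open>Deleting a vertex of degree below \<open>\<delta>\<close> destroys at most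
  \<open>2 * \<delta>\<close> ordered pairs, so the strict inequality persists; the empty set
  violates it, so deletion stops before.\<close>

lemma min_degree_subset:
  fixes R :: "'a \<Rightarrow> 'a \<Rightarrow> bool"
  assumes "finite P" and sym: "\<And>p q. R p q \<Longrightarrow> R q p"
    and "2 * \<delta> * card P < card {(p, q). p \<in> P \<and> q \<in> P \<and> R p q}"
  shows "\<exists>S\<subseteq>P. S \<noteq> {} \<and> (\<forall>p\<in>S. \<delta> \<le> card {q \<in> S. R p q})"
  using assms(1,3)
proof (induction "card P" arbitrary: P)
  case 0
  then show ?case by simp
next
  case (Suc k)
  show ?case
  proof (cases "\<forall>p\<in>P. \<delta> \<le> card {q \<in> P. R p q}")
    case True
    then show ?thesis using Suc.hyps(2) by (intro exI[of _ P]) auto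
  next
    case False
    then obtain p where p: "p \<in> P" "card {q \<in> P. R p q} < \<delta>" by (auto simp: not_le)
    let ?N = "{q \<in> P. R p q}" and ?P = "P - {p}"
    let ?W = "\<lambda>P. {(p, q). p \<in> P \<and> q \<in> P \<and> R p q}"
    have fN: "finite ?N" using Suc.prems(1) by simp
    have fW: "finite (?W ?P)"
      by (rule finite_subset[of _ "P \<times> P"]) (use Suc.prems(1) in auto)
    have "card (?W P) \<le> card (?W ?P \<union> (Pair p ` ?N \<union> (\<lambda>q. (q, p)) ` ?N))"
      using fN fW sym by (intro card_mono) auto
    also have "\<dots> \<le> card (?W ?P) + (card (Pair p ` ?N) + card ((\<lambda>q. (q, p)) ` ?N))"
      by (meson add_le_mono card_Un_le le_refl order_trans)
    also have "\<dots> \<le> card (?W ?P) + 2 * \<delta>"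
      using card_image_le[OF fN, of "Pair p"] card_image_le[OF fN, of "\<lambda>q. (q, p)"] p(2) by linarith
    finally have W: "card (?W P) \<le> card (?W ?P) + 2 * \<delta>" .
    have k: "k = card ?P" using Suc.hyps(2) p(1) Suc.prems(1) by simp
    have "2 * \<delta> * card P = 2 * \<delta> * card ?P + 2 * \<delta>" using Suc.hyps(2)[symmetric] k by simp
    then have "2 * \<delta> * card ?P < card (?W ?P)" using W Suc.prems(2) by linarith
    from Suc.hyps(1)[OF k _ this] Suc.prems(1) obtain S where
      "S \<subseteq> ?P" "S \<noteq> {}" "\<forall>p\<in>S. \<delta> \<le> card {q \<in> S. R p q}" by auto
    then show ?thesis by blast
  qed
qed

section \<open>Ordered edges of equal colour\<close>

text \<open>Two ordered edges (u, v) and (u', v') of one colour are stored as ((u, u'), (v, v')),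
  the form of an edge of the auxiliary graph. They are disjoint so that a split of the vertices can
  separate them.\<close>

definition quads :: "(nat set \<Rightarrow> nat) \<Rightarrow> nat \<Rightarrow> ((nat \<times> nat) \<times> (nat \<times> nat)) set" where
  "quads c n = {(p, q). p \<in> {..<n} \<times> {..<n} \<and> q \<in> {..<n} \<times> {..<n} \<and> pair_adj c p q \<and>
    {fst p, fst q} \<inter> {snd p, snd q} = {}}"

lemma finite_quads: "finite (quads c n)"
  by (rule finite_subset[of _ "({..<n} \<times> {..<n}) \<times> ({..<n} \<times> {..<n})"]) (auto simp: quads_def)

text \<open>Cauchy-Schwarz over the colour classes bounds the number of equally coloured pairs of
  ordered edges from below. By propriety such edges are disjoint or equal as sets; the latter
  happens in two orientations and gives the term \<open>2 * (n * (n - 1))\<close>.\<close>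

lemma card_quads_ge:
  assumes c: "proper_edge_coloring (complete_graph n) c"
  shows "(n * (n - 1))\<^sup>2 \<le>
    card (c ` edges (complete_graph n)) * (card (quads c n) + 2 * (n * (n - 1)))"
proof -
  define D where "D = (SIGMA u:{..<n}. {..<n} - {u})"
  define col where "col = (\<lambda>d. c {fst d, snd d} :: nat)"
  define K where "K = c ` edges (complete_graph n)"
  define g where "g = (\<lambda>\<kappa>. card {d \<in> D. col d = \<kappa>})"
  define M where "M = (SIGMA d:D. {d' \<in> D. col d' = col d})"
  have D: "d \<in> D \<longleftrightarrow> fst d < n \<and> snd d < n \<and> fst d \<noteq> snd d" for d
    by (cases d) (auto simp: D_def)
  have fD: "finite D" by (simp add: D_def)
  have cD: "card D = n * (n - 1)" by (simp add: D_def)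
  have fK: "finite K" by (simp add: K_def complete_graph_def finite_imp_finite_nsets)
  have colK: "col ` D \<subseteq> K"
  proof
    fix \<kappa> assume "\<kappa> \<in> col ` D"
    then obtain d where d: "d \<in> D" "\<kappa> = col d" by blast
    then have "{fst d, snd d} \<in> [{..<n}]\<^bsup>2\<^esup>" by (simp add: D)
    then show "\<kappa> \<in> K" using d by (auto simp: K_def complete_graph_def col_def)
  qed
  have "card D = (\<Sum>\<kappa>\<in>K. g \<kappa>)"
    using sum.group[OF fD fK colK, of "\<lambda>_. 1 :: nat"] by (simp add: g_def)
  moreover have "card M = (\<Sum>\<kappa>\<in>K. (g \<kappa>)\<^sup>2)"
  proof -
    have "card M = (\<Sum>d\<in>D. g (col d))"
      unfolding M_def g_def using fD by (subst card_SigmaI) auto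
    also have "\<dots> = (\<Sum>\<kappa>\<in>K. \<Sum>d\<in>{d \<in> D. col d = \<kappa>}. g (col d))"
      by (rule sum.group[OF fD fK colK, symmetric])
    also have "\<dots> = (\<Sum>\<kappa>\<in>K. (g \<kappa>)\<^sup>2)"
      by (rule sum.cong) (simp_all add: power2_eq_square g_def)
    finally show ?thesis .
  qed
  moreover have "(\<Sum>\<kappa>\<in>K. real (g \<kappa>))\<^sup>2 \<le> (\<Sum>\<kappa>\<in>K. (real (g \<kappa>))\<^sup>2) * card K"
    by (rule sum_squared_le_sum_of_squares)
  ultimately have "real ((card D)\<^sup>2) \<le> real (card K * card M)" by (simp add: mult.commute)
  then have 1: "(card D)\<^sup>2 \<le> card K * card M" by (simp only: of_nat_le_iff)
  let ?f = "\<lambda>w. ((fst (fst w), fst (snd w)), (snd (fst w), snd (snd w)))"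
  have "M \<subseteq> ?f ` quads c n \<union> ((\<lambda>d. (d, d)) ` D \<union> (\<lambda>d. (d, (snd d, fst d))) ` D)"
  proof
    fix w assume "w \<in> M"
    then obtain u v u' v' where w: "w = ((u, v), (u', v'))" by (metis prod.collapse)
    have uv: "u < n" "v < n" "u' < n" "v' < n" "u \<noteq> v" "u' \<noteq> v'" "c {u, v} = c {u', v'}"
      using \<open>w \<in> M\<close> by (auto simp: M_def w D col_def)
    show "w \<in> ?f ` quads c n \<union> ((\<lambda>d. (d, d)) ` D \<union> (\<lambda>d. (d, (snd d, fst d))) ` D)"
    proof (cases "{u, v} \<inter> {u', v'} = {}")
      case True
      then have "((u, u'), (v, v')) \<in> quads c n" using uv by (simp add: quads_def pair_adj_def)
      then show ?thesis unfolding w by force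
    next
      case False
      have e: "{u, v} \<in> edges (complete_graph n)" "{u', v'} \<in> edges (complete_graph n)"
        using uv by (auto simp: complete_graph_def)
      have "{u, v} = {u', v'}"
        using bspec[OF bspec[OF c[unfolded proper_edge_coloring_def] e(1)] e(2)] False uv(7) by argo
      then have "(u' = u \<and> v' = v) \<or> (u' = v \<and> v' = u)" by (auto simp: doubleton_eq_iff)
      moreover have "(u, v) \<in> D" using uv by (simp add: D)
      ultimately show ?thesis unfolding w by force
    qed
  qed
  then have "card M \<le> card (?f ` quads c n \<union> ((\<lambda>d. (d, d)) ` D \<union> (\<lambda>d. (d, (snd d, fst d))) ` D))"
    using fD finite_quads by (intro card_mono) auto
  also have "\<dots> \<le> card (?f ` quads c n) + (card ((\<lambda>d. (d, d)) ` D) + card ((\<lambda>d. (d, (snd d, fst d))) ` D))"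
    by (intro order_trans[OF card_Un_le] add_left_mono card_Un_le)
  also have "\<dots> \<le> card (quads c n) + (card D + card D)"
    by (intro add_mono card_image_le finite_quads fD)
  also have "\<dots> = card (quads c n) + 2 * card D" by simp
  finally have "card K * card M \<le> card K * (card (quads c n) + 2 * card D)" by (rule mult_le_mono2)
  with 1 show ?thesis unfolding cD K_def by linarith
qed

section \<open>Splitting the vertex set\<close>

text \<open>Membership in \<open>X\<close> is prescribed for at most four elements and free for all
  others.\<close>

lemma card_splitting_sets:
  assumes "S \<subseteq> V" "T \<subseteq> V" "S \<inter> T = {}" "card S \<le> 2" "card T \<le> 2" "finite V"
  shows "2 ^ card V \<le> 16 * card {X \<in> Pow V. S \<subseteq> X \<and> X \<inter> T = {}}"
proof -
  have "finite (S \<union> T)" using assms finite_subset by blast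
  then have "card V - 4 \<le> card (V - (S \<union> T))"
    using assms(4,5) card_Un_le[of S T] diff_card_le_card_Diff[of "S \<union> T" V] by linarith
  then have "(2::nat) ^ card V \<le> 2 ^ (4 + card (V - (S \<union> T)))"
    by (intro power_increasing) auto
  also have "\<dots> = 16 * card (Pow (V - (S \<union> T)))"
    using assms(6) by (simp add: card_Pow power_add)
  also have "\<dots> = 16 * card ((\<union>) S ` Pow (V - (S \<union> T)))"
    by (subst card_image) (auto simp: inj_on_def)
  also have "\<dots> \<le> 16 * card {X \<in> Pow V. S \<subseteq> X \<and> X \<inter> T = {}}"
    using assms by (intro mult_le_mono2 card_mono) auto
  finally show ?thesis .
qed

text \<open>Averaging over all \<open>X\<close>: each quadruple is separated in the required way by
  at least one in sixteen of them.\<close>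

lemma quads_split:
  "\<exists>X\<subseteq>{..<n}. card (quads c n) \<le>
    16 * card {w \<in> quads c n. {fst (fst w), fst (snd w)} \<subseteq> X \<and> X \<inter> {snd (fst w), snd (snd w)} = {}}"
proof (rule ccontr)
  let ?g = "\<lambda>w X. {fst (fst w), fst (snd w)} \<subseteq> X \<and> X \<inter> {snd (fst w), snd (snd w)} = {}"
  let ?Q = "quads c n" and ?V = "{..<n}"
  assume "\<not> ?thesis"
  then have less: "16 * card {w \<in> ?Q. ?g w X} < card ?Q" if "X \<subseteq> ?V" for X
    using that by (meson linorder_not_le)
  have "2 ^ n * card ?Q = (\<Sum>w\<in>?Q. 2 ^ card ?V)" by simp
  also have "\<dots> \<le> (\<Sum>w\<in>?Q. 16 * card {X \<in> Pow ?V. ?g w X})"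
  proof (rule sum_mono)
    fix w assume "w \<in> ?Q"
    then show "2 ^ card ?V \<le> 16 * card {X \<in> Pow ?V. ?g w X}"
      by (intro card_splitting_sets) (auto simp: quads_def card_insert_if)
  qed
  also have "\<dots> = 16 * (\<Sum>w\<in>?Q. card {X \<in> Pow ?V. ?g w X})" by (simp add: sum_distrib_left)
  also have "(\<Sum>w\<in>?Q. card {X \<in> Pow ?V. ?g w X}) = (\<Sum>X\<in>Pow ?V. card {w \<in> ?Q. ?g w X})"
    by (rule sum_multicount_gen[OF finite_quads]) auto
  also have "16 * \<dots> = (\<Sum>X\<in>Pow ?V. 16 * card {w \<in> ?Q. ?g w X})" by (simp add: sum_distrib_left)
  also have "\<dots> < (\<Sum>X\<in>Pow ?V. card ?Q)"
    by (rule sum_strict_mono) (use less in auto)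
  also have "\<dots> = 2 ^ n * card ?Q" by (simp add: card_Pow)
  finally show False by simp
qed

text \<open>A dense auxiliary graph between \<open>X\<close> and its complement would contain a
  subset of minimum degree \<open>\<delta>\<close>, hence the copies. The factor 32 is 16 from the
  split times 2 from the passage to minimum degree.\<close>

lemma coloring_bound:
  fixes c :: "nat set \<Rightarrow> nat"
  assumes c: "proper_edge_coloring (complete_graph n) c"
    and no: "\<not> has_color_isomorphic_copies 2 (subdivision1 (complete_graph t)) (complete_graph n) c"
    and t: "t \<ge> 2" and \<delta>: "\<delta> > 0"
    and big: "growth_threshold t \<le> \<delta> * (min 1 (light_gain t * (real \<delta>)\<^sup>2 / (4 * (real n)\<^sup>2))) ^ (t - 2)"
  shows "(n * (n - 1))\<^sup>2 \<le> card (c ` edges (complete_graph n)) * (32 * \<delta> * n\<^sup>2 + 2 * (n * (n - 1)))"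
proof -
  obtain X where X: "X \<subseteq> {..<n}" "card (quads c n) \<le>
      16 * card {w \<in> quads c n. {fst (fst w), fst (snd w)} \<subseteq> X \<and> X \<inter> {snd (fst w), snd (snd w)} = {}}"
    using quads_split by blast
  define Y where "Y = {..<n} - X"
  define P where "P = X \<times> Y"
  have PV: "P \<subseteq> {..<n} \<times> {..<n}" using X(1) by (auto simp: P_def Y_def)
  then have fP: "finite P" using finite_subset by blast
  have cP: "card P \<le> n\<^sup>2" using card_mono[OF _ PV] by (simp add: card_cartesian_product power2_eq_square)
  let ?W = "{(p, q). p \<in> P \<and> q \<in> P \<and> pair_adj c p q}"
  have "card ?W \<le> 2 * \<delta> * card P"
  proof (rule ccontr)
    assume "\<not> ?thesis"
    then have "2 * \<delta> * card P < card ?W" by simp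
    from min_degree_subset[OF fP pair_adj_sym this]
    obtain S where S: "S \<subseteq> P" "S \<noteq> {}" "\<And>p. p \<in> S \<Longrightarrow> \<delta> \<le> card {q \<in> S. pair_adj c p q}"
      by blast
    have cS: "card S > 0" "card S \<le> n\<^sup>2"
      using S(2) cP card_mono[OF fP S(1)] finite_subset[OF S(1) fP] by (simp_all add: card_gt_0_iff)
    then have "n > 0" by (cases n) auto
    have "real (card S) \<le> (real n)\<^sup>2" using cS(2) by (metis of_nat_le_iff of_nat_power)
    \<comment> \<open>\<open>big\<close> uses the upper bound \<open>n\<^sup>2\<close> for |S|; a
      smaller set only increases the quotient.\<close>
    then have "light_gain t * (real \<delta>)\<^sup>2 / (4 * (real n)\<^sup>2) \<le> light_gain t * (real \<delta>)\<^sup>2 / (4 * card S)"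
      using cS \<open>n > 0\<close> t light_gain_pos[of t] by (intro divide_left_mono) auto
    then have "min 1 (light_gain t * (real \<delta>)\<^sup>2 / (4 * (real n)\<^sup>2)) ^ (t - 2)
        \<le> min 1 (light_gain t * (real \<delta>)\<^sup>2 / (4 * card S)) ^ (t - 2)"
      using t light_gain_pos[of t] by (intro power_mono) (auto simp: min_def)
    then have "growth_threshold t \<le> \<delta> * min 1 (light_gain t * (real \<delta>)\<^sup>2 / (4 * card S)) ^ (t - 2)"
      using big by (meson mult_left_mono of_nat_0_le_iff order_trans)
    then have "has_color_isomorphic_copies 2 (subdivision1 (complete_graph t)) (complete_graph n) c"
      using S X(1) unfolding P_def
      by (intro copies_if_min_degree[OF c _ _ _ _ _ \<delta> _ t, of X Y S]) (auto simp: Y_def)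
    then show False using no by simp
  qed
  also have "\<dots> \<le> 2 * \<delta> * n\<^sup>2" using cP by simp
  finally have W: "card ?W \<le> 2 * \<delta> * n\<^sup>2" .
  have fW: "finite ?W" by (rule finite_subset[of _ "P \<times> P"]) (use fP in auto)
  have "card {w \<in> quads c n. {fst (fst w), fst (snd w)} \<subseteq> X \<and> X \<inter> {snd (fst w), snd (snd w)} = {}}
      \<le> card ?W"
    by (rule card_mono[OF fW]) (auto simp: quads_def P_def Y_def)
  then have "card (quads c n) \<le> 32 * \<delta> * n\<^sup>2" using X(2) W by linarith
  then have "card (c ` edges (complete_graph n)) * (card (quads c n) + 2 * (n * (n - 1)))
      \<le> card (c ` edges (complete_graph n)) * (32 * \<delta> * n\<^sup>2 + 2 * (n * (n - 1)))"
    by (intro mult_le_mono2) simp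
  with card_quads_ge[OF c] show ?thesis by (rule order_trans)
qed

section \<open>Choice of the degree and the exponent\<close>

text \<open>Where the minimum is the quotient, the right side is a constant times
  \<open>\<delta> ^ (2 * t - 3) / n ^ (2 * t - 4)\<close>. This dictates the order of
  \<open>\<delta>\<close> as a power of \<open>n\<close>, and \<open>M\<close> absorbs the
  constants.\<close>

lemma threshold_reached:
  fixes M :: real
  assumes t: "t \<ge> 3" and n: "n \<ge> 1"
    and M: "1 \<le> M" "growth_threshold t * (4 / light_gain t) ^ (t - 2) \<le> M"
    and \<delta>: "M * n powr ((2 * real t - 4) / (2 * real t - 3)) \<le> real \<delta>"
  shows "growth_threshold t \<le> \<delta> * (min 1 (light_gain t * (real \<delta>)\<^sup>2 / (4 * (real n)\<^sup>2))) ^ (t - 2)"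
proof -
  define \<theta> where "\<theta> = (2 * real t - 4) / (2 * real t - 3)"
  define q where "q = light_gain t * (real \<delta>)\<^sup>2 / (4 * (real n)\<^sup>2)"
  have \<alpha>: "light_gain t > 0" using t by (intro light_gain_pos) simp
  have R: "growth_threshold t \<ge> 0" using \<alpha> by (simp add: growth_threshold_def bad_loss_def)
  \<comment> \<open>Hence \<open>M\<close> is at least \<open>growth_threshold t\<close> itself,
    which settles the case where the minimum is 1.\<close>
  have t4: "4 / light_gain t \<ge> 1"
  proof -
    have "1 * 1 \<le> 4 * real t * real (heavy_bound t)"
      using t by (intro mult_mono) (auto simp: heavy_bound_def)
    then have "light_gain t \<le> 1" by (simp add: light_gain_def)
    then show ?thesis using \<alpha> by simp
  qed
  have th: "\<theta> \<ge> 0" using t by (simp add: \<theta>_def)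
  have np: "real n powr \<theta> \<ge> 1" using n th by (simp add: ge_one_powr_ge_zero)
  show ?thesis
  proof (cases "q \<ge> 1")
    case True
    have "growth_threshold t * 1 \<le> growth_threshold t * (4 / light_gain t) ^ (t - 2)"
      using R t4 by (intro mult_left_mono one_le_power)
    also have "\<dots> \<le> M * 1" using M by simp
    also have "\<dots> \<le> M * real n powr \<theta>" using np M(1) by (intro mult_left_mono) auto
    also have "\<dots> \<le> \<delta>" using \<delta> by (simp add: \<theta>_def)
    finally show ?thesis using True by (simp add: q_def[symmetric])
  next
    case False
    \<comment> \<open>As \<open>M\<close> is at least 1, it may be raised to the power
      \<open>2 * t - 3\<close>.\<close>
    have "M * (real n powr \<theta>) ^ (2 * t - 3) \<le> M ^ (2 * t - 3) * (real n powr \<theta>) ^ (2 * t - 3)"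
      using M(1) t by (intro mult_right_mono self_le_power) auto
    also have "\<dots> \<le> real \<delta> ^ (2 * t - 3)"
      unfolding power_mult_distrib[symmetric]
      using \<delta> M(1) by (intro power_mono) (auto simp: \<theta>_def)
    also have "(real n powr \<theta>) ^ (2 * t - 3) = real n powr (2 * real t - 4)"
      using t n by (simp add: powr_power \<theta>_def of_nat_diff)
    also have "\<dots> = real n ^ (2 * (t - 2))"
      using t n by (subst powr_realpow[symmetric]) (auto simp: of_nat_diff algebra_simps)
    finally have *: "M * real n ^ (2 * (t - 2)) \<le> real \<delta> ^ (2 * t - 3)" .
    have "growth_threshold t \<le> M * (light_gain t / 4) ^ (t - 2)"
      using M(2) \<alpha> by (simp add: power_divide field_simps)
    also have "\<dots> = M * real n ^ (2 * (t - 2)) * (light_gain t / (4 * (real n)\<^sup>2)) ^ (t - 2)"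
      using n by (simp add: power_divide power_mult_distrib power_mult)
    also have "\<dots> \<le> real \<delta> ^ (2 * t - 3) * (light_gain t / (4 * (real n)\<^sup>2)) ^ (t - 2)"
      using * \<alpha> by (intro mult_right_mono) auto
    also have "2 * t - 3 = Suc (2 * (t - 2))" using t by simp
    also have "real \<delta> ^ Suc (2 * (t - 2)) * (light_gain t / (4 * (real n)\<^sup>2)) ^ (t - 2) = \<delta> * q ^ (t - 2)"
      by (simp add: q_def power_divide power_mult_distrib power_mult)
    finally show ?thesis using False by (simp add: q_def[symmetric])
  qed
qed

theorem theorem1p4:
  fixes t :: nat
  assumes "t \<ge> 3"
  shows "(\<lambda>n. real (f_col 2 n (subdivision1 (complete_graph t))))
           \<in> \<Omega>(\<lambda>n. real n powr (1 + 1 / (2 * real t - 3)))"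
proof -
  define M where "M = max 1 (growth_threshold t * (4 / light_gain t) ^ (t - 2))"
  define \<theta> where "\<theta> = (2 * real t - 4) / (2 * real t - 3)"
  have M: "1 \<le> M" "growth_threshold t * (4 / light_gain t) ^ (t - 2) \<le> M" by (simp_all add: M_def)
  let ?H = "subdivision1 (complete_graph t)"
  have "is_graph ?H"
    by (rule is_graph_subdivision1) (simp add: is_graph_def complete_graph_def)
  moreover have "edges ?H \<noteq> {}"
  proof -
    have "{0, 1} \<in> edges (complete_graph t)" using assms by (simp add: complete_graph_def)
    then have "{Inl 0, Inr {0, 1}} \<in> edges ?H" by (auto simp: subdivision1_def)
    then show ?thesis by blast
  qed
  ultimately have attained: "\<exists>c :: nat set \<Rightarrow> nat.
      proper_edge_coloring (complete_graph n) c \<and>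
      card (c ` edges (complete_graph n)) = f_col 2 n ?H \<and>
      \<not> has_color_isomorphic_copies 2 ?H (complete_graph n) c" for n
    by (rule f_col_attained) simp
  have bound: "1 / (136 * (M + 1)) * real n powr (1 + 1 / (2 * real t - 3)) \<le> f_col 2 n ?H"
    if n: "n \<ge> 2" for n
  proof -
    obtain c :: "nat set \<Rightarrow> nat" where c: "proper_edge_coloring (complete_graph n) c"
      "card (c ` edges (complete_graph n)) = f_col 2 n ?H"
      "\<not> has_color_isomorphic_copies 2 ?H (complete_graph n) c"
      using attained by blast
    define C where "C = f_col 2 n ?H"
    \<comment> \<open>The least degree that \<open>threshold_reached\<close> accepts; rounding up
      replaces \<open>M\<close> by at most \<open>M + 1\<close>.\<close>
    define \<delta> where "\<delta> = nat \<lceil>M * real n powr \<theta>\<rceil>"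
    have np: "real n powr \<theta> \<ge> 1"
      using n assms by (simp add: ge_one_powr_ge_zero \<theta>_def)
    have Mn: "M * real n powr \<theta> \<ge> 1" using M(1) np mult_mono[of 1 M 1 "real n powr \<theta>"] by simp
    have \<delta>1: "M * real n powr \<theta> \<le> \<delta>" unfolding \<delta>_def by (rule real_nat_ceiling_ge)
    have "real \<delta> < M * real n powr \<theta> + 1" unfolding \<delta>_def using Mn by linarith
    then have \<delta>2: "real \<delta> \<le> (M + 1) * real n powr \<theta>" using np by (simp add: algebra_simps)
    have \<delta>0: "real \<delta> \<ge> 1" using Mn \<delta>1 by linarith
    have "growth_threshold t \<le> \<delta> * (min 1 (light_gain t * (real \<delta>)\<^sup>2 / (4 * (real n)\<^sup>2))) ^ (t - 2)"
      using n \<delta>1 by (intro threshold_reached[OF assms _ M]) (auto simp: \<theta>_def)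
    then have "(n * (n - 1))\<^sup>2 \<le> C * (32 * \<delta> * n\<^sup>2 + 2 * (n * (n - 1)))"
      unfolding C_def c(2)[symmetric]
      using assms \<delta>0 by (intro coloring_bound[OF c(1,3)]) auto
    \<comment> \<open>The contribution of coinciding edges is absorbed because
      \<open>\<delta>\<close> is at least 1.\<close>
    also have "\<dots> \<le> C * (34 * \<delta> * n\<^sup>2)"
    proof (rule mult_le_mono2)
      have "n * (n - 1) \<le> n * n" by simp
      also have "\<dots> \<le> \<delta> * (n * n)" using \<delta>0 by simp
      finally show "32 * \<delta> * n\<^sup>2 + 2 * (n * (n - 1)) \<le> 34 * \<delta> * n\<^sup>2"
        by (simp add: power2_eq_square)
    qed
    finally have "real ((n * (n - 1))\<^sup>2) \<le> real (C * (34 * \<delta> * n\<^sup>2))" by (simp only: of_nat_le_iff)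
    then have "(real n)\<^sup>2 * (real n - 1)\<^sup>2 \<le> (real n)\<^sup>2 * (34 * C * \<delta>)"
      using n by (simp add: of_nat_diff power_mult_distrib mult_ac)
    then have "(real n - 1)\<^sup>2 \<le> 34 * C * \<delta>" using n by simp
    \<comment> \<open>For \<open>n\<close> at least 2, \<open>n - 1\<close> is at least half of
      \<open>n\<close>; the resulting factor 4 turns 34 into 136.\<close>
    moreover have "(real n / 2)\<^sup>2 \<le> (real n - 1)\<^sup>2" using n by (intro power_mono) auto
    ultimately have "(real n)\<^sup>2 \<le> 136 * real C * real \<delta>" by (simp add: power_divide)
    also have "\<dots> \<le> 136 * real C * ((M + 1) * real n powr \<theta>)" using \<delta>2 by (intro mult_left_mono) auto
    finally have "(real n)\<^sup>2 \<le> (136 * (M + 1) * C) * real n powr \<theta>" by (simp add: algebra_simps)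
    \<comment> \<open>Since \<open>\<theta>\<close> equals 1 - 1/(2t - 3), the exponents add up to
      2, and cancelling \<open>n powr \<theta>\<close> leaves the claimed power.\<close>
    moreover have "(real n)\<^sup>2 = real n powr (1 + 1 / (2 * real t - 3)) * real n powr \<theta>"
    proof -
      have "\<theta> = ((2 * real t - 3) - 1) / (2 * real t - 3)" by (simp add: \<theta>_def)
      also have "\<dots> = 1 - 1 / (2 * real t - 3)" using assms by (subst diff_divide_distrib) simp
      finally have sum2: "1 + 1 / (2 * real t - 3) + \<theta> = 2" by simp
      have "real n powr (1 + 1 / (2 * real t - 3)) * real n powr \<theta> = real n powr 2"
        unfolding powr_add[symmetric] sum2 ..
      then show ?thesis using n by simp
    qed
    ultimately have "real n powr (1 + 1 / (2 * real t - 3)) * real n powr \<theta>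
        \<le> (136 * (M + 1) * C) * real n powr \<theta>" by (simp only:)
    then have "real n powr (1 + 1 / (2 * real t - 3)) \<le> 136 * (M + 1) * C"
      by (rule mult_right_le_imp_le) (use np in linarith)
    then show ?thesis using M(1) by (simp add: C_def field_simps)
  qed
  show ?thesis
  proof (rule landau_omega.bigI)
    show "0 < 1 / (136 * (M + 1))" using M(1) by simp
    show "\<forall>\<^sub>F n in sequentially. 1 / (136 * (M + 1)) * norm (real n powr (1 + 1 / (2 * real t - 3)))
        \<le> norm (real (f_col 2 n ?H))"
      using eventually_ge_at_top[of 2] by eventually_elim (use bound in simp)
  qed
qed

end
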